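(* Let $P$ be a p-string with $m=|P|$ and $\Pi_P\neq\emptyset$, and let $k=|\Pi_P|+2$. All prefix periods $p$ of $P$ together with the values $\mathrm{reach}_P(p)$ can be computed in $O(m)$ time and $O(\log m+|\Pi|)$ extra space.
   Context: Let $\Sigma$ and $\Pi$ be disjoint finite alphabets (constant and parameter characters); a p-string is a string over $\Sigma\cup\Pi$, indexed from 0, with $w[i:j]=w[i]\cdots w[j-1]$. A permutation $f$ of $\Pi$ acts on p-strings letterwise, fixing letters of $\Sigma$. $x\equiv y$ iff $f(x)=y$ for some permutation $f$ of $\Pi$. For $p\in\mathbb{N}^+$ with $p\le|w|$, $p$ is a period of $w$ iff $w[0:|w|-p]\equiv w[p:|w|]$; for nonempty $w$, $\mathrm{period}(w)$ is its smallest period. $\Pi_w$ is the set of parameter characters occurring in $w$. With $k=|\Pi_P|+2$, a positive integer $p$ is a prefix period of $P$ iff there is a prefix $w'$ of $P$ with $\mathrm{period}(w')=p$ and $p\le |w'|/k$. For $0<p\le|P|$, $\mathrm{reach}_P(p)=\max\{r\in\mathbb{N}: r\le|P| \text{ and } p \text{ is a period of } P[0:r]\}$. Computing model: functions $\Pi\to\mathbb{N}$ can be stored as arrays with constant-time access. *)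

theory Defs
  imports
    Complex_Main
    "HOL-Library.Sublist"
    "HOL-Combinatorics.Permutations"
begin

section \<open>Parameterized strings\<close>

text \<open>
  A permutation \<open>f permutes Par\<close> is the identity outside \<open>Par\<close>, in particular on the constant
  characters; the alphabet of constants is therefore not an argument of the notions below.
\<close>

definition pmatch :: "'a set \<Rightarrow> 'a list \<Rightarrow> 'a list \<Rightarrow> bool" where
  "pmatch Par x y \<longleftrightarrow> (\<exists>f. f permutes Par \<and> map f x = y)"

definition slice :: "'a list \<Rightarrow> nat \<Rightarrow> nat \<Rightarrow> 'a list" where
  "slice w i j = take (j - i) (drop i w)"

definition is_period :: "'a set \<Rightarrow> 'a list \<Rightarrow> nat \<Rightarrow> bool" where
  "is_period Par w p \<longleftrightarrow>
     0 < p \<and> p \<le> length w \<and>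
     pmatch Par (slice w 0 (length w - p)) (slice w p (length w))"

text \<open>Meaningful for nonempty \<open>w\<close> only, which then has the period \<open>length w\<close>.\<close>

definition period :: "'a set \<Rightarrow> 'a list \<Rightarrow> nat" where
  "period Par w = (LEAST p. is_period Par w p)"

definition params :: "'a set \<Rightarrow> 'a list \<Rightarrow> 'a set" where
  "params Par w = set w \<inter> Par"

definition is_prefix_period :: "'a set \<Rightarrow> 'a list \<Rightarrow> nat \<Rightarrow> bool" where
  "is_prefix_period Par P p \<longleftrightarrow>
     (let k = card (params Par P) + 2 in
      0 < p \<and>
      (\<exists>w'. prefix w' P \<and> w' \<noteq> [] \<and> period Par w' = p \<and> real p \<le> real (length w') / real k))"

definition reach :: "'a set \<Rightarrow> 'a list \<Rightarrow> nat \<Rightarrow> nat" where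
  "reach Par P p = Max {r. r \<le> length P \<and> is_period Par (slice P 0 r) p}"

section \<open>The computing model\<close>

text \<open>
  A word RAM, programmed with while programs. Its storage consists of

  \<^item> the input \<open>P\<close>, which is read-only;
  \<^item> the registers occurring in the program;
  \<^item> a work memory of finitely many cells with addresses \<open>0, 1, \<dots>\<close>;
  \<^item> the arrays occurring in the program, each a function from \<open>Par\<close> to words.

  All stored values are words, that is, naturals below the bound \<open>W\<close>. Characters are opaque:
  a program denotes a character by a position of the input at which it occurs. Two characters can
  be compared for equality, a character can be tested for being a parameter, and a
  parameter can be used as an index of an array.

  The type parameters are the names of registers and of arrays. The functions
  \<open>regs\<close> and \<open>arrs\<close> generated with the type of programs yield the names occurring in a program.
\<close>

datatype (regs_aexp: 'v, arrs_aexp: 'b) aexp =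
    Const nat
  | Reg 'v
  | Len                                                   \<comment> \<open>length of the input\<close>
  | Mem "('v, 'b) aexp"                                   \<comment> \<open>cell with the given address\<close>
  | Arr 'b "('v, 'b) aexp"                                \<comment> \<open>array entry at the character \<open>P ! i\<close>\<close>
  | Add "('v, 'b) aexp" "('v, 'b) aexp"
  | Sub "('v, 'b) aexp" "('v, 'b) aexp"                   \<comment> \<open>truncated at 0\<close>
  | Mul "('v, 'b) aexp" "('v, 'b) aexp"
  | Div "('v, 'b) aexp" "('v, 'b) aexp"

datatype (regs_bexp: 'v, arrs_bexp: 'b) bexp =
    Less "('v, 'b) aexp" "('v, 'b) aexp"
  | Eq "('v, 'b) aexp" "('v, 'b) aexp"
  | SameChar "('v, 'b) aexp" "('v, 'b) aexp"              \<comment> \<open>\<open>P ! i = P ! j\<close>\<close>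
  | IsParam "('v, 'b) aexp"                               \<comment> \<open>\<open>P ! i \<in> Par\<close>\<close>
  | Neg "('v, 'b) bexp"
  | Conj "('v, 'b) bexp" "('v, 'b) bexp"

datatype (regs: 'v, arrs: 'b) com =
    Skip
  | SetReg 'v "('v, 'b) aexp"
  | SetMem "('v, 'b) aexp" "('v, 'b) aexp"
  | SetArr 'b "('v, 'b) aexp" "('v, 'b) aexp"
  | Seq "('v, 'b) com" "('v, 'b) com"
  | Cond "('v, 'b) bexp" "('v, 'b) com" "('v, 'b) com"
  | While "('v, 'b) bexp" "('v, 'b) com"

record ('v, 'b, 'a) state =
  reg :: "'v \<Rightarrow> nat"
  mem :: "nat list"
  arr :: "'b \<Rightarrow> 'a \<Rightarrow> nat"

text \<open>
  Evaluation yields \<open>None\<close> in case of an overflow or of an access outside the input, outside the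
  work memory or outside the index set \<open>Par\<close> of an array.
\<close>

definition word :: "nat \<Rightarrow> nat \<Rightarrow> nat option" where
  "word W n = (if n < W then Some n else None)"

definition char_at :: "'a list \<Rightarrow> nat \<Rightarrow> 'a option" where
  "char_at P i = (if i < length P then Some (P ! i) else None)"

definition param_at :: "'a set \<Rightarrow> 'a list \<Rightarrow> nat \<Rightarrow> 'a option" where
  "param_at Par P i = (if i < length P \<and> P ! i \<in> Par then Some (P ! i) else None)"

fun lift2 :: "('x \<Rightarrow> 'y \<Rightarrow> 'z) \<Rightarrow> 'x option \<Rightarrow> 'y option \<Rightarrow> 'z option" where
  "lift2 f (Some x) (Some y) = Some (f x y)"
| "lift2 f _ _ = None"

primrec aval ::
  "nat \<Rightarrow> 'a set \<Rightarrow> 'a list \<Rightarrow> ('v, 'b, 'a) state \<Rightarrow> ('v, 'b) aexp \<Rightarrow> nat option" where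
  "aval W Par P s (Const n) = word W n"
| "aval W Par P s (Reg x) = Some (reg s x)"
| "aval W Par P s Len = word W (length P)"
| "aval W Par P s (Mem e) =
     Option.bind (aval W Par P s e) (\<lambda>i. if i < length (mem s) then Some (mem s ! i) else None)"
| "aval W Par P s (Arr b e) =
     map_option (arr s b) (Option.bind (aval W Par P s e) (param_at Par P))"
| "aval W Par P s (Add d e) = Option.bind (lift2 (+) (aval W Par P s d) (aval W Par P s e)) (word W)"
| "aval W Par P s (Sub d e) = lift2 (-) (aval W Par P s d) (aval W Par P s e)"
| "aval W Par P s (Mul d e) = Option.bind (lift2 (*) (aval W Par P s d) (aval W Par P s e)) (word W)"
| "aval W Par P s (Div d e) = lift2 (div) (aval W Par P s d) (aval W Par P s e)"

primrec bval ::
  "nat \<Rightarrow> 'a set \<Rightarrow> 'a list \<Rightarrow> ('v, 'b, 'a) state \<Rightarrow> ('v, 'b) bexp \<Rightarrow> bool option" where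
  "bval W Par P s (Less d e) = lift2 (<) (aval W Par P s d) (aval W Par P s e)"
| "bval W Par P s (Eq d e) = lift2 (=) (aval W Par P s d) (aval W Par P s e)"
| "bval W Par P s (SameChar d e) =
     lift2 (=) (Option.bind (aval W Par P s d) (char_at P)) (Option.bind (aval W Par P s e) (char_at P))"
| "bval W Par P s (IsParam e) =
     map_option (\<lambda>a. a \<in> Par) (Option.bind (aval W Par P s e) (char_at P))"
| "bval W Par P s (Neg b) = map_option Not (bval W Par P s b)"
| "bval W Par P s (Conj b c) = lift2 (\<and>) (bval W Par P s b) (bval W Par P s c)"

text \<open>
  \<open>exec W Par P c s t s'\<close>: started in \<open>s\<close>, the program \<open>c\<close> halts in \<open>s'\<close> after \<open>t\<close> steps. Assignments
  and tests take one step each, which is the usual unit cost up to a constant factor depending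
  only on the program, as it bounds the size of the expressions. A run that evaluates an
  expression to \<open>None\<close> gets stuck and does not halt.
\<close>

inductive exec ::
  "nat \<Rightarrow> 'a set \<Rightarrow> 'a list \<Rightarrow> ('v, 'b) com \<Rightarrow> ('v, 'b, 'a) state \<Rightarrow> nat \<Rightarrow> ('v, 'b, 'a) state \<Rightarrow> bool"
  for W Par P where
  Skip: "exec W Par P Skip s 1 s"
| SetReg: "aval W Par P s e = Some n \<Longrightarrow>
    exec W Par P (SetReg x e) s 1 (s\<lparr>reg := (reg s)(x := n)\<rparr>)"
| SetMem: "aval W Par P s d = Some i \<Longrightarrow> i < length (mem s) \<Longrightarrow> aval W Par P s e = Some n \<Longrightarrow>
    exec W Par P (SetMem d e) s 1 (s\<lparr>mem := (mem s)[i := n]\<rparr>)"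
| SetArr: "Option.bind (aval W Par P s d) (param_at Par P) = Some a \<Longrightarrow> aval W Par P s e = Some n \<Longrightarrow>
    exec W Par P (SetArr b d e) s 1 (s\<lparr>arr := (arr s)(b := (arr s b)(a := n))\<rparr>)"
| Seq: "exec W Par P c s t s' \<Longrightarrow> exec W Par P d s' u s'' \<Longrightarrow>
    exec W Par P (Seq c d) s (t + u) s''"
| CondTrue: "bval W Par P s b = Some True \<Longrightarrow> exec W Par P c s t s' \<Longrightarrow>
    exec W Par P (Cond b c d) s (1 + t) s'"
| CondFalse: "bval W Par P s b = Some False \<Longrightarrow> exec W Par P d s t s' \<Longrightarrow>
    exec W Par P (Cond b c d) s (1 + t) s'"
| WhileFalse: "bval W Par P s b = Some False \<Longrightarrow>
    exec W Par P (While b c) s 1 s"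
| WhileTrue: "bval W Par P s b = Some True \<Longrightarrow> exec W Par P c s t s' \<Longrightarrow>
    exec W Par P (While b c) s' u s'' \<Longrightarrow> exec W Par P (While b c) s (1 + t + u) s''"

text \<open>
  The storage is not assumed to be initialised; any state with a work memory of \<open>S\<close> cells
  and with all values below \<open>W\<close> is a possible start state.
\<close>

definition start_state :: "nat \<Rightarrow> 'a set \<Rightarrow> nat \<Rightarrow> ('v, 'b, 'a) state \<Rightarrow> bool" where
  "start_state W Par S s \<longleftrightarrow>
     length (mem s) = S \<and> (\<forall>n \<in> set (mem s). n < W) \<and>
     (\<forall>x. reg s x < W) \<and> (\<forall>b. \<forall>a \<in> Par. arr s b a < W)"

text \<open>
  Number of words taken by a program with a work memory of \<open>S\<close> cells, the input not counted.
\<close>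

definition extra_space :: "('v, 'b) com \<Rightarrow> 'a set \<Rightarrow> nat \<Rightarrow> nat" where
  "extra_space c Par S = card (regs c) + card (arrs c) * card Par + S"

text \<open>
  Output convention for a list of pairs: its length is in register 0, and its entries
  occupy an initial part of the work memory, two cells each. Thus the output is part of the extra space.
\<close>

definition returns_pairs :: "(nat, 'b, 'a) state \<Rightarrow> (nat \<times> nat) list \<Rightarrow> bool" where
  "returns_pairs s xs \<longleftrightarrow>
     reg s 0 = length xs \<and> 2 * length xs \<le> length (mem s) \<and>
     (\<forall>i < length xs. xs ! i = (mem s ! (2 * i), mem s ! (2 * i + 1)))"

end

theory Submission imports Defs begin

text \<open>
  Let \<open>k = |\<Pi>\<^sub>P| + 2\<close>. A position \<open>p\<close> is a prefix period iff \<open>k p \<le> reach p\<close> and \<open>reach p\<close> exceeds the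
  reach of every smaller prefix period. As in the algorithm of Galil and Seiferas, \<open>p\<close> runs through
  the candidates in increasing order while \<open>q\<close> is the length of a match between \<open>P\<close> and its suffix
  at \<open>p\<close>. At a mismatch \<open>reach p = p + q\<close>. If a later prefix period is \<open>p + d\<close> with \<open>k d \<le> q\<close>, then \<open>d\<close>
  is a period of \<open>P[0:q]\<close>; so if \<open>P[0:q]\<close> has a prefix period \<open>x\<close> with \<open>k x \<le> q\<close> as its period, one may
  move on to \<open>(p + x, q - x)\<close>, and otherwise to \<open>(p + q div k + 1, 0)\<close>. Candidates beyond \<open>m div k\<close> are
  irrelevant, hence the factor \<open>k\<close> lost in shifts of the second kind costs only \<open>O(m)\<close> in total.

  The renaming of parameters is not stored, since it would have to be recomputed after each shift.
  A parameter \<open>b\<close> that occurs in the window at position \<open>j\<close> corresponds to \<open>P ! (j - p)\<close>, and one that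
  does not must be matched with a parameter at its first occurrence in \<open>P\<close>.

  Two periods of overlapping factors extend to their union if the overlap is long enough for the
  orbits of the permutation to be visible; this forces consecutive prefix periods to grow by a factor
  of at least \<open>3/2\<close>, so there are \<open>O(log m)\<close> of them.
\<close>

section \<open>Matches and periods\<close>

text \<open>The match of two factors of \<open>P\<close>, given by start positions and a length, so
  that truncation, shifting and composition become index arithmetic.\<close>

definition align :: "'a set \<Rightarrow> 'a list \<Rightarrow> nat \<Rightarrow> nat \<Rightarrow> nat \<Rightarrow> bool" where
  "align Par P a b n \<longleftrightarrow> (\<exists>f. f permutes Par \<and> (\<forall>i<n. f (P ! (a + i)) = P ! (b + i)))"

lemma align_mono: "align Par P a b n \<Longrightarrow> n' \<le> n \<Longrightarrow> align Par P a b n'"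
  unfolding align_def by (meson order_less_le_trans)

lemma align_sym: assumes "align Par P a b n" shows "align Par P b a n"
proof -
  obtain f where f: "f permutes Par" "\<forall>i<n. f (P ! (a + i)) = P ! (b + i)"
    using assms unfolding align_def by blast
  have "\<forall>i<n. inv f (P ! (b + i)) = P ! (a + i)"
    using f permutes_inverses(2)[OF f(1)] by metis
  then show ?thesis
    using permutes_inv[OF f(1)] unfolding align_def by blast
qed

lemma align_trans:
  assumes "align Par P a b n" "align Par P b c n" shows "align Par P a c n"
proof -
  obtain f g where f: "f permutes Par" "\<forall>i<n. f (P ! (a + i)) = P ! (b + i)"
    and g: "g permutes Par" "\<forall>i<n. g (P ! (b + i)) = P ! (c + i)"
    using assms unfolding align_def by blast
  have "\<forall>i<n. (g \<circ> f) (P ! (a + i)) = P ! (c + i)"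
    using f g by simp
  then show ?thesis
    using permutes_compose[OF f(1) g(1)] unfolding align_def by blast
qed

lemma align_shift:
  assumes "align Par P a b n" "d + n' \<le> n" shows "align Par P (a + d) (b + d) n'"
proof -
  obtain f where f: "f permutes Par" "\<forall>i<n. f (P ! (a + i)) = P ! (b + i)"
    using assms unfolding align_def by blast
  have "\<forall>i<n'. f (P ! (a + d + i)) = P ! (b + d + i)"
    using f(2) assms(2) by (simp add: add.assoc)
  with f(1) show ?thesis unfolding align_def by blast
qed

lemma align_0: "align Par P a b 0"
  unfolding align_def by (auto intro: permutes_id)

text \<open>The complements of \<open>A\<close> and of its image in \<open>Par\<close> are
  equinumerous, so any bijection between them completes \<open>g\<close>.\<close>

lemma injection_extends_to_permutation:
  assumes "finite Par" "A \<subseteq> Par" "g ` A \<subseteq> Par" "inj_on g A"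
  obtains f where "f permutes Par" "\<forall>x\<in>A. f x = g x"
proof -
  have fin: "finite A" "finite (g ` A)" using assms finite_subset by blast+
  have "card (Par - A) = card (Par - g ` A)"
    using assms fin by (simp add: card_Diff_subset card_image)
  then obtain h where h: "bij_betw h (Par - A) (Par - g ` A)"
    using assms(1) finite_same_card_bij[of "Par - A" "Par - g ` A"] by auto
  let ?f = "\<lambda>x. if x \<in> A then g x else if x \<in> Par then h x else x"
  have "bij_betw ?f A (g ` A)"
    using assms(4) by (auto simp: bij_betw_def inj_on_def)
  moreover have "bij_betw ?f (Par - A) (Par - g ` A)"
    by (subst bij_betw_cong[where g = h]) (use h in auto)
  ultimately have "bij_betw ?f (A \<union> (Par - A)) (g ` A \<union> (Par - g ` A))"
    by (rule bij_betw_combine) blast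
  moreover have "A \<union> (Par - A) = Par" "g ` A \<union> (Par - g ` A) = Par"
    using assms(2,3) by auto
  ultimately have "bij_betw ?f Par Par" by simp
  then have "?f permutes Par"
    by (rule bij_imp_permutes) (use assms(2) in auto)
  then show thesis using that by auto
qed

text \<open>Eliminates the unknown permutation. The equality pattern makes the map from
  \<open>P ! (a + i)\<close> to \<open>P ! (b + i)\<close> well defined and injective; its
  restriction to parameters extends to a permutation.\<close>

lemma align_iff_pattern:
  assumes "finite Par"
  shows "align Par P a b n \<longleftrightarrow>
    (\<forall>i<n. (P ! (a + i) \<in> Par \<longleftrightarrow> P ! (b + i) \<in> Par) \<and>
           (P ! (a + i) \<notin> Par \<longrightarrow> P ! (a + i) = P ! (b + i))) \<and>
    (\<forall>i<n. \<forall>j<n. P ! (a + i) = P ! (a + j) \<longleftrightarrow> P ! (b + i) = P ! (b + j))"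
  (is "_ \<longleftrightarrow> ?letters \<and> ?pairs")
proof
  assume "align Par P a b n"
  then obtain f where f: "f permutes Par" "\<forall>i<n. f (P ! (a + i)) = P ! (b + i)"
    unfolding align_def by blast
  have fx: "f x \<in> Par \<longleftrightarrow> x \<in> Par" "x \<notin> Par \<Longrightarrow> f x = x" "f x = f y \<longleftrightarrow> x = y" for x y
    using permutes_in_image[OF f(1)] permutes_not_in[OF f(1)] permutes_inj[OF f(1)]
    by (auto simp: inj_eq)
  have eq: "P ! (b + i) = f (P ! (a + i))" if "i < n" for i using f(2) that by simp
  show "?letters \<and> ?pairs" by (simp add: eq fx)
next
  assume *: "?letters \<and> ?pairs"
  define A where "A = (\<lambda>i. P ! (a + i)) ` {i. i < n \<and> P ! (a + i) \<in> Par}"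
  \<comment> \<open>The choice of the occurrence is immaterial: equal letters in the first factor
    face equal letters in the second.\<close>
  define g where "g x = P ! (b + (SOME i. i < n \<and> P ! (a + i) = x))" for x
  have g: "g (P ! (a + i)) = P ! (b + i)" if "i < n" for i
  proof -
    define j where "j = (SOME j. j < n \<and> P ! (a + j) = P ! (a + i))"
    have "j < n \<and> P ! (a + j) = P ! (a + i)"
      unfolding j_def by (rule someI[where x = i]) (use that in simp)
    then have "P ! (b + j) = P ! (b + i)" using * that by blast
    then show ?thesis unfolding g_def j_def .
  qed
  have "inj_on g A"
    using * g unfolding inj_on_def A_def by auto
  moreover have "g ` A \<subseteq> Par" "A \<subseteq> Par"
    using * g unfolding A_def by auto
  ultimately obtain f where f: "f permutes Par" "\<forall>x\<in>A. f x = g x"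
    using injection_extends_to_permutation[OF assms] by metis
  have "f (P ! (a + i)) = P ! (b + i)" if "i < n" for i
  proof (cases "P ! (a + i) \<in> Par")
    case True
    then show ?thesis using f(2) g that unfolding A_def by auto
  next
    case False
    then show ?thesis using * that permutes_not_in[OF f(1)] by metis
  qed
  then show "align Par P a b n" using f(1) unfolding align_def by blast
qed

text \<open>Basis of the letter-by-letter comparison: the pair condition is reflexive and symmetric,
  so only pairs of an earlier position with the new one remain to be checked.\<close>

lemma align_Suc_iff:
  assumes "finite Par" "align Par P a b n"
  shows "align Par P a b (Suc n) \<longleftrightarrow>
    (P ! (a + n) \<in> Par \<longleftrightarrow> P ! (b + n) \<in> Par) \<and>
    (P ! (a + n) \<notin> Par \<longrightarrow> P ! (a + n) = P ! (b + n)) \<and>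
    (\<forall>i<n. P ! (a + i) = P ! (a + n) \<longleftrightarrow> P ! (b + i) = P ! (b + n))"
proof -
  define L where "L i \<longleftrightarrow> (P ! (a + i) \<in> Par \<longleftrightarrow> P ! (b + i) \<in> Par) \<and>
    (P ! (a + i) \<notin> Par \<longrightarrow> P ! (a + i) = P ! (b + i))" for i
  define R where "R i j \<longleftrightarrow> (P ! (a + i) = P ! (a + j) \<longleftrightarrow> P ! (b + i) = P ! (b + j))" for i j
  have iff: "align Par P a b n' \<longleftrightarrow> (\<forall>i<n'. L i) \<and> (\<forall>i<n'. \<forall>j<n'. R i j)" for n'
    unfolding align_iff_pattern[OF assms(1)] L_def R_def ..
  have "R i i" "R i j \<Longrightarrow> R j i" for i j by (auto simp: R_def)
  then have "align Par P a b (Suc n) \<longleftrightarrow> L n \<and> (\<forall>i<n. R i n)"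
    using assms(2) unfolding iff All_less_Suc by blast
  then show ?thesis unfolding L_def R_def by (simp only: conj_assoc)
qed

lemma pmatch_iff_align:
  assumes "a + n \<le> length P" "b + n \<le> length P"
  shows "pmatch Par (slice P a (a + n)) (slice P b (b + n)) \<longleftrightarrow> align Par P a b n"
  using assms unfolding pmatch_def align_def slice_def list_eq_iff_nth_eq by auto

lemma slice_of_prefix:
  assumes "j \<le> r" "r \<le> length P" 
  shows "slice (take r P) i j = slice P i j"
  using assms unfolding slice_def by (simp add: take_drop min_def)

definition prefix_has_period :: "'a set \<Rightarrow> 'a list \<Rightarrow> nat \<Rightarrow> nat \<Rightarrow> bool" where
  "prefix_has_period Par P p r \<longleftrightarrow> 0 < p \<and> p \<le> r \<and> r \<le> length P \<and> align Par P 0 p (r - p)"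

lemma is_period_take_iff:
  assumes "r \<le> length P"
  shows "is_period Par (take r P) p \<longleftrightarrow> prefix_has_period Par P p r"
proof (cases "0 < p \<and> p \<le> r")
  case True
  have "pmatch Par (slice (take r P) 0 (r - p)) (slice (take r P) p r) \<longleftrightarrow> align Par P 0 p (r - p)"
    using pmatch_iff_align[of 0 "r - p" P p Par] True assms by (simp add: slice_of_prefix)
  then show ?thesis
    using True assms by (simp add: is_period_def prefix_has_period_def min_absorb2)
next
  case False
  then show ?thesis using assms by (auto simp: is_period_def prefix_has_period_def)
qed

lemma prefix_has_period_mono:
  "prefix_has_period Par P p r \<Longrightarrow> p \<le> r' \<Longrightarrow> r' \<le> r \<Longrightarrow> prefix_has_period Par P p r'"
  unfolding prefix_has_period_def using align_mono by (metis diff_le_mono le_trans)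

lemma prefix_has_period_self: "0 < r \<Longrightarrow> r \<le> length P \<Longrightarrow> prefix_has_period Par P r r"
  unfolding prefix_has_period_def by (simp add: align_0)

text \<open>The lengths at which \<open>p\<close> is a period are closed under shrinking down to
  \<open>p\<close>, so a single failure at \<open>Suc r\<close> excludes all longer
  prefixes.\<close>

lemma reach_eqI:
  assumes "prefix_has_period Par P p r"
    "r = length P \<or> \<not> prefix_has_period Par P p (Suc r)"
  shows "reach Par P p = r"
  unfolding reach_def
proof (rule Max_eqI)
  have "finite {..length P}" by simp
  then show "finite {r. r \<le> length P \<and> is_period Par (slice P 0 r) p}"
    by (rule rev_finite_subset) auto
  show "r \<in> {r. r \<le> length P \<and> is_period Par (slice P 0 r) p}"
    using assms(1) is_period_take_iff[of r P Par p]
    by (auto simp: slice_def prefix_has_period_def)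
  fix r' assume "r' \<in> {r. r \<le> length P \<and> is_period Par (slice P 0 r) p}"
  then have r': "r' \<le> length P" "prefix_has_period Par P p r'"
    using is_period_take_iff[of r' P Par p] by (auto simp: slice_def)
  show "r' \<le> r"
  proof (rule ccontr)
    assume "\<not> r' \<le> r"
    then have "prefix_has_period Par P p (Suc r)"
      using prefix_has_period_mono[OF r'(2), of "Suc r"] assms(1)
      by (simp add: prefix_has_period_def)
    with assms(2) r' \<open>\<not> r' \<le> r\<close> show False by simp
  qed
qed

lemma prefix_has_period_iff_le_reach:
  assumes "0 < p" "p \<le> r" "r \<le> length P"
  shows "prefix_has_period Par P p r \<longleftrightarrow> r \<le> reach Par P p"
proof -
  have p: "prefix_has_period Par P p p" 
    using assms by (intro prefix_has_period_self) simp_all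
  \<comment> \<open>The greatest length exists because \<open>p\<close> is trivially a period of the
    prefix of length \<open>p\<close>.\<close>
  let ?r = "GREATEST r. prefix_has_period Par P p r"
  have b: "\<forall>r. prefix_has_period Par P p r \<longrightarrow> r \<le> length P"
    by (simp add: prefix_has_period_def)
  have g: "prefix_has_period Par P p ?r"
    using GreatestI_nat[of "\<lambda>r. prefix_has_period Par P p r", OF p] b by blast
  have le: "prefix_has_period Par P p r \<Longrightarrow> r \<le> ?r" for r
    using Greatest_le_nat[of "\<lambda>r. prefix_has_period Par P p r" r] b by blast
  have "reach Par P p = ?r"
    by (rule reach_eqI[OF g]) (use le[of "Suc ?r"] in auto)
  then show ?thesis using g le[of r] prefix_has_period_mono[OF g, of r] assms by auto
qed

lemma reach_le_length: 
  assumes "0 < p" "p \<le> length P" shows "reach Par P p \<le> length P"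
proof (rule ccontr)
  let ?A = "{r. r \<le> length P \<and> is_period Par (slice P 0 r) p}"
  have "p \<in> ?A"
    using is_period_take_iff[of p P Par p] prefix_has_period_self[of p P Par] assms
    by (simp add: slice_def)
  moreover have "finite ?A"
    by (rule finite_subset[of _ "{..length P}"]) auto
  ultimately have "Max ?A \<in> ?A" by (metis Max_in emptyE)
  moreover assume "\<not> reach Par P p \<le> length P"
  ultimately show False by (simp add: reach_def)
qed

section \<open>Prefix periods\<close>

text \<open>Removes \<open>LEAST\<close> and the real quotient: minimality becomes the failure of
  all smaller periods, and the quotient bound becomes a product bound.\<close>

lemma is_prefix_period_iff:
  "is_prefix_period Par P p \<longleftrightarrow> 0 < p \<and> (\<exists>r. (card (params Par P) + 2) * p \<le> r \<and>
     prefix_has_period Par P p r \<and> (\<forall>p'<p. \<not> prefix_has_period Par P p' r))"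
proof -
  let ?k = "card (params Par P) + 2"
  have per: "period Par (take r P) = p \<longleftrightarrow>
      prefix_has_period Par P p r \<and> (\<forall>p'<p. \<not> prefix_has_period Par P p' r)"
    if "0 < r" "r \<le> length P" for r
  proof -
    let ?q = "LEAST p. prefix_has_period Par P p r"
    have "is_period Par (take r P) = (\<lambda>p. prefix_has_period Par P p r)"
      using is_period_take_iff[OF that(2)] by (intro ext)
    then have "period Par (take r P) = ?q" by (simp add: period_def)
    moreover have "prefix_has_period Par P ?q r"
      using prefix_has_period_self[OF that] by (rule LeastI)
    ultimately show ?thesis
      using not_less_Least Least_le by (metis linorder_neqE_nat)
  qed
  have real: "real p \<le> real r / real ?k \<longleftrightarrow> ?k * p \<le> r" for r
  proof -
    have "real p \<le> real r / real ?k \<longleftrightarrow> real p * real ?k \<le> real r"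
      by (rule pos_le_divide_eq) simp
    also have "\<dots> \<longleftrightarrow> p * ?k \<le> r" unfolding of_nat_mult[symmetric] of_nat_le_iff ..
    finally show ?thesis by (simp add: mult.commute)
  qed
  have "is_prefix_period Par P p \<longleftrightarrow>
      0 < p \<and> (\<exists>w'. prefix w' P \<and> w' \<noteq> [] \<and> period Par w' = p \<and> ?k * p \<le> length w')"
    unfolding is_prefix_period_def Let_def real ..
  also have "\<dots> \<longleftrightarrow> 0 < p \<and> (\<exists>r. 0 < r \<and> r \<le> length P \<and> period Par (take r P) = p \<and> ?k * p \<le> r)"
    (is "?L \<longleftrightarrow> ?R")
  proof
    assume ?L
    then obtain w' where w: "0 < p" "prefix w' P" "w' \<noteq> []" "period Par w' = p" "?k * p \<le> length w'" by blast
    then have "w' = take (length w') P" "length w' \<le> length P"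
      by (auto simp: prefix_def)
    then show ?R using w by (intro conjI exI[where x = "length w'"]) auto
  next
    assume ?R
    then obtain r where r: "0 < p" "0 < r" "r \<le> length P" "period Par (take r P) = p" "?k * p \<le> r" by blast
    then show ?L by (intro conjI exI[where x = "take r P"]) (auto simp: take_is_prefix)
  qed
  also have "\<dots> \<longleftrightarrow> 0 < p \<and> (\<exists>r. 0 < r \<and> r \<le> length P \<and>
      (prefix_has_period Par P p r \<and> (\<forall>p'<p. \<not> prefix_has_period Par P p' r)) \<and> ?k * p \<le> r)"
    using per by (metis (no_types, lifting))
  also have "\<dots> \<longleftrightarrow> 0 < p \<and> (\<exists>r. ?k * p \<le> r \<and>
      prefix_has_period Par P p r \<and> (\<forall>p'<p. \<not> prefix_has_period Par P p' r))"
  proof -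
    have "0 < r \<and> r \<le> length P" if "prefix_has_period Par P p r" for r
      using that by (auto simp: prefix_has_period_def)
    then show ?thesis by blast
  qed
  finally show ?thesis .
qed

section \<open>Geometric growth and number of the prefix periods\<close>

text \<open>
  Any \<open>|\<Pi>\<^sub>P|\<close> consecutive blocks of length \<open>d\<close> contain full orbits of \<open>g\<close>, hence \<open>g\<close> and \<open>h\<close> agree on all
  characters of the overlap, and these are closed under both.
\<close>

lemma overlapping_periods:
  assumes ne: "params Par P \<noteq> {}"
    and g: "g permutes Par" "\<And>i. i + d < s \<Longrightarrow> g (P ! i) = P ! (i + d)"
    and h: "h permutes Par" "\<And>i. t \<le> i \<Longrightarrow> i + d < e \<Longrightarrow> h (P ! i) = P ! (i + d)"
    and d: "0 < d" and overlap: "t + (card (params Par P) + 1) * d \<le> s"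
    and s: "s \<le> length P" "s \<le> e"
    and i: "i + d < e"
  shows "g (P ! i) = P ! (i + d)"
proof -
  let ?n = "card (params Par P)"
  have finP: "finite (params Par P)" by (simp add: params_def)
  then have n: "0 < ?n" using ne by (simp add: card_gt_0_iff)
  \<comment> \<open>The characters met in \<open>?n\<close> consecutive blocks of length
    \<open>d\<close> from position \<open>t\<close> on, written as iterates of
    \<open>g\<close>.\<close>
  define U where "U = {(g ^^ j) (P ! i) | i j. t \<le> i \<and> i < t + d \<and> j < ?n}"
  have pow: "(g ^^ j) (P ! i) = P ! (i + j * d)" if "i + j * d < s" for i j
    using that
  proof (induction j)
    case (Suc j)
    then show ?case using g(2)[of "i + j * d"] by (simp add: algebra_simps)
  qed simp
  have full: "(g ^^ ?n) (P ! i) \<in> U" if i: "t \<le> i" "i < t + d" for i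
  proof (cases "P ! i \<in> Par")
    case False
    then have "(g ^^ j) (P ! i) = P ! i" for j
      by (induction j) (auto simp: permutes_not_in[OF g(1)])
    then show ?thesis using i n unfolding U_def by (metis (mono_tags, lifting) mem_Collect_eq)
  next
    case True
    \<comment> \<open>Pigeonhole: \<open>?n + 1\<close> iterates lie among \<open>?n\<close>
      parameters, so two coincide, and cutting out the cycle turns the iterate \<open>?n\<close>
      into an earlier one.\<close>
    have "(\<lambda>j. (g ^^ j) (P ! i)) ` {..?n} \<subseteq> params Par P"
    proof safe
      fix j assume "j \<le> ?n"
      then have "j * d \<le> ?n * d" by (rule mult_le_mono1)
      moreover have "(?n + 1) * d = ?n * d + d" by simp
      ultimately have lt: "i + j * d < s" using i overlap by linarith
      have "(g ^^ j) (P ! i) \<in> Par"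
        by (induction j) (auto simp: True permutes_in_image[OF g(1)])
      then show "(g ^^ j) (P ! i) \<in> params Par P"
        using pow[OF lt] lt s by (auto simp: params_def)
    qed
    then have "card ((\<lambda>j. (g ^^ j) (P ! i)) ` {..?n}) < card {..?n}"
      using card_mono[OF finP] by (metis card_atMost less_Suc_eq_le)
    then have "\<not> inj_on (\<lambda>j. (g ^^ j) (P ! i)) {..?n}" by (rule pigeonhole)
    then obtain a b where ab: "a \<le> ?n" "b \<le> ?n" "a < b" "(g ^^ a) (P ! i) = (g ^^ b) (P ! i)"
      unfolding inj_on_def by (metis atMost_iff linorder_neqE_nat)
    have "(g ^^ ?n) (P ! i) = (g ^^ (?n - b)) ((g ^^ b) (P ! i))"
      using ab(2) by (metis comp_apply funpow_add le_add_diff_inverse2)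
    also have "\<dots> = (g ^^ (?n - b + a)) (P ! i)"
      using ab(4) by (simp add: funpow_add)
    finally have "(g ^^ ?n) (P ! i) = (g ^^ (?n - b + a)) (P ! i)" .
    moreover have "?n - b + a < ?n" using ab(2,3) by simp
    ultimately show ?thesis using i unfolding U_def by blast
  qed
  have closed: "g x \<in> U" if x: "x \<in> U" for x
  proof -
    obtain i j where ij: "t \<le> i" "i < t + d" "j < ?n" "x = (g ^^ j) (P ! i)"
      using x unfolding U_def by blast
    have gx: "g x = (g ^^ Suc j) (P ! i)" using ij(4) by simp
    show ?thesis
    proof (cases "Suc j = ?n")
      case True
      then show ?thesis using full[OF ij(1,2)] gx by simp
    next
      case False
      then have "Suc j < ?n" using ij(3) by simp
      then show ?thesis using gx ij(1,2) unfolding U_def by blast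
    qed
  qed
  have agree: "h x = g x" if x: "x \<in> U" for x
  proof -
    obtain i j where ij: "t \<le> i" "i < t + d" "j < ?n" "x = (g ^^ j) (P ! i)"
      using x unfolding U_def by blast
    have "Suc j * d \<le> ?n * d" using ij(3) by (intro mult_le_mono1) simp
    then have lt: "i + j * d + d < s" using ij(2) overlap by simp
    then have "x = P ! (i + j * d)" using pow[of i j] ij(4) by simp
    then show ?thesis using g(2)[OF lt] h(2)[of "i + j * d"] lt s(2) ij(1) by simp
  qed
  \<comment> \<open>Membership propagates to the right end in steps of \<open>d\<close>: on
    \<open>U\<close> the map \<open>h\<close> agrees with \<open>g\<close>, and \<open>g\<close>
    preserves \<open>U\<close>.\<close>
  have in_U: "P ! i \<in> U" if "t \<le> i" "i < e" for i
    using that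
  proof (induction i rule: less_induct)
    case (less i)
    show ?case
    proof (cases "i < t + d")
      case True
      then have "(g ^^ 0) (P ! i) \<in> U" using less.prems n unfolding U_def by blast
      then show ?thesis by simp
    next
      case False
      then have "P ! (i - d) \<in> U" using less d by simp
      moreover have "h (P ! (i - d)) = P ! i" using False h(2)[of "i - d"] less.prems by simp
      ultimately show ?thesis using closed agree by metis
    qed
  qed
  show ?thesis
  proof (cases "t \<le> i")
    case True
    then show ?thesis using h(2)[OF True i] agree in_U[OF True] i by simp
  next
    case False
    then show ?thesis using g(2)[of i] overlap by simp
  qed
qed

text \<open>
  Otherwise \<open>q - p\<close> is a period of the factors \<open>[0, r - p)\<close> and \<open>[p, r)\<close>, where \<open>r\<close> is a length at which
  \<open>p\<close> is the smallest period, and then also of their union.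
\<close>

lemma prefix_periods_grow:
  assumes ne: "params Par P \<noteq> {}"
    and pp: "is_prefix_period Par P p" "is_prefix_period Par P q" and "p < q"
  shows "3 * p \<le> 2 * q"
proof (rule ccontr)
  assume "\<not> 3 * p \<le> 2 * q"
  define n where "n = card (params Par P)"
  have n: "0 < n" using ne by (simp add: n_def card_gt_0_iff params_def)
  obtain r where r: "0 < p" "(n + 2) * p \<le> r" "prefix_has_period Par P p r"
      "\<And>p'. p' < p \<Longrightarrow> \<not> prefix_has_period Par P p' r"
    using pp(1) unfolding is_prefix_period_iff n_def by blast
  obtain r' where r': "(n + 2) * q \<le> r'" "prefix_has_period Par P q r'"
      "\<not> prefix_has_period Par P p r'"
    using pp(2) \<open>p < q\<close> unfolding is_prefix_period_iff n_def by blast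
  have "3 * p \<le> (n + 2) * p" using n by (intro mult_le_mono1) simp
  then have r3: "3 * p \<le> r" using r(2) by linarith
  have "q \<le> r'" using r'(1) by (simp add: algebra_simps)
  \<comment> \<open>The period \<open>p\<close> holds at \<open>r\<close> but fails at
    \<open>r'\<close>, where \<open>q\<close> is smallest.\<close>
  then have "r < r'"
    using r(1) r'(3) \<open>p < q\<close> prefix_has_period_mono[OF r(3), of r'] by force
  then have qr: "prefix_has_period Par P q r"
    using prefix_has_period_mono[OF r'(2), of r] r3 \<open>\<not> 3 * p \<le> 2 * q\<close> by simp
  define d where "d = q - p"
  have d: "0 < d" "q = p + d" "2 * d < p" using \<open>p < q\<close> \<open>\<not> 3 * p \<le> 2 * q\<close> by (auto simp: d_def)
  have ap: "align Par P 0 p (r - p)" and aq: "align Par P 0 q (r - q)" and rP: "r \<le> length P"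
    using r(3) qr by (auto simp: prefix_has_period_def)
  \<comment> \<open>The period \<open>p\<close>, shifted by \<open>d\<close>, matches the factors at
    \<open>d\<close> and \<open>q\<close>, and the period \<open>q\<close> matches those at
    \<open>0\<close> and \<open>q\<close>; hence those at \<open>0\<close> and \<open>d\<close>
    match.\<close>
  have "align Par P (0 + d) (p + d) (r - q)"
    using ap by (rule align_shift) (use d r3 in simp)
  then have dq: "align Par P d q (r - q)" using d by simp
  then have "align Par P 0 d (r - q)" using align_trans[OF aq align_sym] by blast
  then obtain g where g: "g permutes Par" "\<And>i. i < r - q \<Longrightarrow> g (P ! i) = P ! (d + i)"
    unfolding align_def by auto
  \<comment> \<open>Likewise the factors at \<open>p\<close> and \<open>q\<close> match, both being
    copies of the one at \<open>0\<close>.\<close>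
  have "align Par P p 0 (r - q)" using align_mono[OF align_sym[OF ap]] d by simp
  then have "align Par P p q (r - q)" using aq align_trans by blast
  then obtain h where h: "h permutes Par" "\<And>i. i < r - q \<Longrightarrow> h (P ! (p + i)) = P ! (q + i)"
    unfolding align_def by auto
  \<comment> \<open>From \<open>2 * d < p\<close> and \<open>1 \<le> n\<close>:
    \<open>(n + 1) * d \<le> 2 * n * d \<le> n * p \<le> r - 2 * p\<close>.\<close>
  have "n * (2 * d) \<le> n * p" by (intro mult_le_mono2) (use d in simp)
  moreover have "1 * d \<le> n * d" by (intro mult_le_mono1) (use n in simp)
  moreover have "(n + 1) * d = n * d + d" "(n + 2) * p = n * p + 2 * p" "n * (2 * d) = 2 * (n * d)"
    by simp_all
  ultimately have overlap: "p + (n + 1) * d \<le> r - p" using r(2) by linarith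
  have "g (P ! i) = P ! (i + d)" if "i + d < r" for i
  proof (rule overlapping_periods[OF ne g(1) _ h(1) _ d(1) overlap[unfolded n_def] _ _ that])
    show "g (P ! i) = P ! (i + d)" if "i + d < r - p" for i
      using g(2)[of i] that d by (simp add: add.commute)
    show "h (P ! i) = P ! (i + d)" if "p \<le> i" "i + d < r" for i
      using h(2)[of "i - p"] that d by (simp add: add.commute)
  qed (use rP in auto)
  then have "align Par P 0 d (r - d)"
    using g(1) unfolding align_def by (auto simp: add.commute)
  then have "prefix_has_period Par P d r"
    using d r3 rP by (simp add: prefix_has_period_def)
  then show False using r(4)[of d] d by simp
qed

lemma is_prefix_period_bounds:
  assumes "is_prefix_period Par P p"
  shows "0 < p" "(card (params Par P) + 2) * p \<le> reach Par P p"
    "p \<le> length P div (card (params Par P) + 2)" "p \<le> length P"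
proof -
  let ?k = "card (params Par P) + 2"
  obtain r where r: "0 < p" "?k * p \<le> r" "prefix_has_period Par P p r"
    using assms unfolding is_prefix_period_iff by blast
  show "0 < p" by fact
  have le: "p \<le> r" "r \<le> length P" using r(3) by (auto simp: prefix_has_period_def)
  then show "?k * p \<le> reach Par P p" "p \<le> length P"
    using prefix_has_period_iff_le_reach[OF r(1) le] r by auto
  have "?k * p \<le> length P" using r le by simp
  then show "p \<le> length P div ?k" by (simp add: less_eq_div_iff_mult_less_eq mult.commute)
qed

lemma finite_prefix_periods: "finite {p. is_prefix_period Par P p}"
  by (rule finite_subset[of _ "{..length P}"]) (auto dest: is_prefix_period_bounds)

lemma nth_ge_geometric:
  assumes "\<And>i. Suc i < length xs \<Longrightarrow> 3 * xs ! i \<le> 2 * (xs ! Suc i :: nat)"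
    and "i < length xs" and "0 < xs ! 0"
  shows "3 ^ i \<le> 2 ^ i * xs ! i"
  using assms(2)
proof (induction i)
  case 0
  then show ?case using assms(3) by simp
next
  case (Suc i)
  then have "3 * 3 ^ i \<le> 2 ^ i * (3 * xs ! i)" by simp
  also have "\<dots> \<le> 2 ^ i * (2 * xs ! Suc i)" using assms(1) Suc.prems by (intro mult_le_mono2) simp
  finally show ?case by simp
qed

text \<open>The largest of \<open>i + 1\<close> prefix periods is at least
  \<open>(3 / 2) ^ i\<close> and at most the length of \<open>P\<close>. Squaring turns the base
  into \<open>9 / 4\<close>, which exceeds \<open>2\<close>; this is the origin of the factor
  2.\<close>

lemma card_prefix_periods:
  assumes "params Par P \<noteq> {}"
  shows "real (card {p. is_prefix_period Par P p}) \<le> 2 * log 2 (length P) + 1"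
proof -
  define xs where "xs = sorted_list_of_set {p. is_prefix_period Par P p}"
  have xs: "sorted_wrt (<) xs" "set xs = {p. is_prefix_period Par P p}"
    "length xs = card {p. is_prefix_period Par P p}"
    using finite_prefix_periods[of Par P] by (simp_all add: xs_def)
  have m: "1 \<le> real (length P)" using assms by (cases P) (auto simp: params_def)
  then have "0 \<le> log 2 (length P)" by (subst zero_le_log_cancel_iff) auto
  show ?thesis
  proof (cases "xs = []")
    case True
    then show ?thesis using xs(3) \<open>0 \<le> log 2 (length P)\<close> by simp
  next
    case False
    define i where "i = length xs - 1"
    have i: "i < length xs" "length xs = Suc i" using False by (auto simp: i_def)
    have mem: "is_prefix_period Par P (xs ! j)" if "j < length xs" for j
      using that nth_mem xs(2) by blast
    have "3 ^ i \<le> 2 ^ i * xs ! i"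
    proof (rule nth_ge_geometric)
      show "3 * xs ! j \<le> 2 * xs ! Suc j" if "Suc j < length xs" for j
        using that mem prefix_periods_grow[OF assms] xs(1)
        by (simp add: sorted_wrt_iff_nth_less)
      show "0 < xs ! 0" using is_prefix_period_bounds(1)[OF mem[of 0]] False by simp
    qed (rule i(1))
    also have "\<dots> \<le> 2 ^ i * length P" using is_prefix_period_bounds(4)[OF mem[OF i(1)]] by simp
    finally have "real (3 ^ i) \<le> real (2 ^ i * length P)" by (simp only: of_nat_le_iff)
    then have "(3 / 2) ^ i \<le> real (length P)" by (simp add: power_divide field_simps)
    then have "((3 / 2) ^ i)\<^sup>2 \<le> (real (length P))\<^sup>2" by (rule power_mono) simp
    moreover have "(2::real) ^ i \<le> (9 / 4) ^ i" by (rule power_mono) simp_all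
    moreover have "((3 / 2 :: real) ^ i)\<^sup>2 = (9 / 4) ^ i" by (simp add: power2_eq_square flip: power_mult_distrib)
    ultimately have "2 ^ i \<le> (real (length P))\<^sup>2" by linarith
    then have "log 2 (2 ^ i) \<le> log 2 ((real (length P))\<^sup>2)" using m by (subst log_le_cancel_iff) auto
    then have "real i \<le> 2 * log 2 (length P)" using m by (simp add: log_nat_power)
    then show ?thesis using xs(3) i by simp
  qed
qed

section \<open>Skipping candidates\<close>

locale pstring =
  fixes Par :: "'a set" and P :: "'a list"
  assumes finite_Par: "finite Par" and params_nonempty: "params Par P \<noteq> {}"
begin

abbreviation "m \<equiv> length P"
abbreviation "prefix_period \<equiv> is_prefix_period Par P"
abbreviation "rch \<equiv> reach Par P"
definition "k = card (params Par P) + 2"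

lemma k_bounds: "3 \<le> k" "k \<le> m + 2"
proof -
  have "0 < card (params Par P)" using params_nonempty by (simp add: card_gt_0_iff params_def)
  then show "3 \<le> k" by (simp add: k_def)
  have "card (params Par P) \<le> card (set P)" by (intro card_mono) (auto simp: params_def)
  then show "k \<le> m + 2" using card_length[of P] by (simp add: k_def)
qed

lemma length_pos: "0 < m" using params_nonempty by (auto simp: params_def)

lemma prefix_period_bounds:
  assumes "prefix_period p"
  shows "0 < p" "k * p \<le> rch p" "p \<le> m div k" "p \<le> m" "rch p \<le> m"
  using is_prefix_period_bounds[OF assms] reach_le_length by (auto simp: k_def)

lemma le_div_k_iff: "p \<le> n div k \<longleftrightarrow> k * p \<le> n"
  using k_bounds by (simp add: less_eq_div_iff_mult_less_eq mult.commute)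

lemma reach_at_mismatch:
  assumes "0 < p" "p + q \<le> m" "align Par P 0 p q" "p + q = m \<or> \<not> align Par P 0 p (Suc q)"
  shows "rch p = p + q"
  by (rule reach_eqI) (use assms in \<open>auto simp: prefix_has_period_def\<close>)

text \<open>The smallest period of the prefix of length \<open>r\<close> works: it is at most
  \<open>d\<close>, so it inherits the bound \<open>k * d \<le> r\<close>, and that prefix itself is
  the witness.\<close>

lemma prefix_period_below:
  assumes "prefix_has_period Par P d r" "k * d \<le> r"
  obtains p where "p \<le> d" "prefix_period p" "k * p \<le> r" "r \<le> rch p"
proof -
  let ?p = "LEAST p. prefix_has_period Par P p r"
  have p: "prefix_has_period Par P ?p r" using assms(1) by (rule LeastI)
  have le: "?p \<le> d" using assms(1) by (rule Least_le)
  then have kp: "k * ?p \<le> r" using assms(2) mult_le_mono2 order_trans by blast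
  have "0 < ?p" using p unfolding prefix_has_period_def by blast
  moreover have "\<forall>p'<?p. \<not> prefix_has_period Par P p' r" using not_less_Least by blast
  ultimately have "prefix_period ?p"
    unfolding is_prefix_period_iff k_def[symmetric] using p kp by blast
  moreover have "r \<le> rch ?p"
    using p prefix_has_period_iff_le_reach[of ?p r P Par] by (auto simp: prefix_has_period_def)
  ultimately show thesis using that le kp by blast
qed

text \<open>This is the test made by the program. Conversely to the plain direction, a period of the
  prefix of length \<open>rch p\<close> below \<open>p\<close> would yield a smaller prefix period
  reaching as far, by \<open>prefix_period_below\<close>.\<close>

lemma prefix_period_iff_record:
  assumes "0 < p" "p \<le> m"
  shows "prefix_period p \<longleftrightarrow> k * p \<le> rch p \<and> (\<forall>x. prefix_period x \<and> x < p \<longrightarrow> rch x < rch p)"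
proof
  assume pp: "prefix_period p"
  then obtain r where r: "prefix_has_period Par P p r" "\<And>p'. p' < p \<Longrightarrow> \<not> prefix_has_period Par P p' r"
    unfolding is_prefix_period_iff by blast
  have pr: "p \<le> r" "r \<le> m" using r(1) by (auto simp: prefix_has_period_def)
  then have "r \<le> rch p" using prefix_has_period_iff_le_reach[OF assms(1)] r(1) by blast
  moreover have "rch x < r" if "prefix_period x" "x < p" for x
    using prefix_has_period_iff_le_reach[of x r P Par] prefix_period_bounds(1)[OF that(1)] that pr r(2)
    by simp
  ultimately show "k * p \<le> rch p \<and> (\<forall>x. prefix_period x \<and> x < p \<longrightarrow> rch x < rch p)"
    using prefix_period_bounds(2)[OF pp] by fastforce
next
  assume *: "k * p \<le> rch p \<and> (\<forall>x. prefix_period x \<and> x < p \<longrightarrow> rch x < rch p)"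
  have "1 * p \<le> k * p" using k_bounds by (intro mult_le_mono1) simp
  then have "p \<le> rch p" using * by linarith
  then have per: "prefix_has_period Par P p (rch p)"
    using prefix_has_period_iff_le_reach[OF assms(1), of "rch p" P Par]
      reach_le_length[OF assms, of Par] by simp
  have "\<not> prefix_has_period Par P p' (rch p)" if "p' < p" for p'
  proof
    assume a: "prefix_has_period Par P p' (rch p)"
    have "k * p' \<le> k * p" using that by (intro mult_le_mono2) simp
    then have "k * p' \<le> rch p" using * by linarith
    then obtain x where "x \<le> p'" "prefix_period x" "rch p \<le> rch x"
      using prefix_period_below[OF a] by metis
    then show False using * that by fastforce
  qed
  then show "prefix_period p"
    unfolding is_prefix_period_iff k_def[symmetric] using per assms(1) * by blast
qed

text \<open>
  A later prefix period \<open>p'\<close> must reach beyond \<open>p + q\<close>, so the prefix of length \<open>q\<close> matches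
  itself after a shift by \<open>p' - p\<close>.
\<close>

lemma later_prefix_period:
  assumes "0 < p" "p + q \<le> m" "align Par P 0 p q" "prefix_period p'" "p < p'" "p' \<le> p + q"
  shows "prefix_has_period Par P (p' - p) q"
proof -
  obtain r where r: "prefix_has_period Par P p' r" "\<not> prefix_has_period Par P p r"
    using assms(4,5) unfolding is_prefix_period_iff by blast
  have p: "prefix_has_period Par P p (p + q)" using assms by (simp add: prefix_has_period_def)
  have "p' \<le> r" using r(1) by (simp add: prefix_has_period_def)
  then have "p + q < r" using prefix_has_period_mono[OF p, of r] r(2) assms(5) by force
  then have "prefix_has_period Par P p' (p + q)" using prefix_has_period_mono[OF r(1)] assms(6) by simp
  moreover have "p + q - p' = q - (p' - p)" using assms(5) by simp
  ultimately have a: "align Par P 0 p' (q - (p' - p))"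
    by (simp add: prefix_has_period_def)
  have "align Par P (0 + (p' - p)) (p + (p' - p)) (q - (p' - p))"
    using assms(3) by (rule align_shift) (use assms(5,6) in simp)
  then have "align Par P (p' - p) p' (q - (p' - p))" using assms(5) by simp
  then have "align Par P 0 (p' - p) (q - (p' - p))" using align_trans[OF a align_sym] by blast
  then show ?thesis using assms by (simp add: prefix_has_period_def)
qed

text \<open>A skipped prefix period \<open>p'\<close> would make \<open>p' - p\<close> a period of
  the prefix of length \<open>q\<close>, and hence produce a prefix period below \<open>x\<close>
  that reaches \<open>q\<close>.\<close>

lemma no_prefix_period_skipped_periodic:
  assumes "0 < p" "p + q \<le> m" "align Par P 0 p q"
    and x: "prefix_period x" "k * x \<le> q" "\<And>y. prefix_period y \<Longrightarrow> y < x \<Longrightarrow> rch y < q"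
    and p': "p < p'" "p' < p + x"
  shows "\<not> prefix_period p'"
proof
  assume pp: "prefix_period p'"
  have "k * (p' - p) \<le> k * x" using p' by (intro mult_le_mono2) simp
  have "1 * x \<le> k * x" using k_bounds by (intro mult_le_mono1) simp
  then have "p' \<le> p + q" using x(2) p'(2) by linarith
  then have "prefix_has_period Par P (p' - p) q"
    using later_prefix_period[OF assms(1-3) pp p'(1)] by simp
  moreover have "k * (p' - p) \<le> q" using \<open>k * (p' - p) \<le> k * x\<close> x(2) by linarith
  ultimately obtain y where "y \<le> p' - p" "prefix_period y" "q \<le> rch y"
    using prefix_period_below by metis
  moreover from this have "y < x" using p' by linarith
  ultimately show False using x(3)[of y] by simp
qed

text \<open>The hypothesis speaks of \<open>x \<le> p\<close> only, because at this moment the list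
  is complete only up to \<open>p\<close>.\<close>

lemma no_prefix_period_skipped_aperiodic:
  assumes "0 < p" "p + q \<le> m" "align Par P 0 p q"
    and none: "\<And>x. prefix_period x \<Longrightarrow> x \<le> p \<Longrightarrow> k * x \<le> q \<Longrightarrow> rch x < q"
    and p': "p < p'" "p' \<le> p + q div k"
  shows "\<not> prefix_period p'"
proof
  assume pp: "prefix_period p'"
  have "p' - p \<le> q div k" using p' by simp
  then have kd: "k * (p' - p) \<le> q" using le_div_k_iff by simp
  have "q div k \<le> q" by simp
  then have "p' \<le> p + q" using p'(2) by linarith
  then have d: "prefix_has_period Par P (p' - p) q"
    using later_prefix_period[OF assms(1-3) pp p'(1)] by simp
  have "1 * (p' - p) \<le> k * (p' - p)" using k_bounds by (intro mult_le_mono1) simp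
  obtain y where y: "y \<le> p' - p" "prefix_period y" "k * y \<le> q" "q \<le> rch y"
    using prefix_period_below[OF d kd] by metis
  \<comment> \<open>A prefix period \<open>y\<close> beyond \<open>p\<close> is not listed yet; but
    then \<open>p\<close> is itself short enough to be a period of the prefix of length
    \<open>q\<close>, and some prefix period up to \<open>p\<close> reaches
    \<open>q\<close>.\<close>
  have "\<not> y \<le> p" using none[of y] y by auto
  then have py: "p < p' - p" "p \<le> q" using y(1) \<open>1 * (p' - p) \<le> k * (p' - p)\<close> kd by linarith+
  have "prefix_has_period Par P p (p + q)" using assms by (simp add: prefix_has_period_def)
  then have "prefix_has_period Par P p q" using prefix_has_period_mono py(2) by fastforce
  moreover have "k * p \<le> k * (p' - p)" using py(1) by (intro mult_le_mono2) simp
  ultimately obtain x where "x \<le> p" "prefix_period x" "k * x \<le> q" "q \<le> rch x"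
    using prefix_period_below[of p q] kd by (metis le_trans)
  then show False using none[of x] by simp
qed

end

section \<open>Weakest preconditions with cost\<close>

text \<open>Total correctness, with the step count visible to the postcondition; a program that gets
  stuck satisfies no postcondition.\<close>

definition wp where
  "wp W Par P c s Q \<longleftrightarrow> (\<exists>t s'. exec W Par P c s t s' \<and> Q t s')"

inductive_simps exec_simps:
  "exec W Par P Skip s t s'"
  "exec W Par P (SetReg x e) s t s'"
  "exec W Par P (SetMem d e) s t s'"
  "exec W Par P (SetArr b d e) s t s'"
  "exec W Par P (Seq c c') s t s'"
  "exec W Par P (Cond tst c c') s t s'"

lemma wp_simps:
  "wp W Par P Skip s Q \<longleftrightarrow> Q 1 s"
  "wp W Par P (SetReg x e) s Q \<longleftrightarrow>
    (\<exists>n. aval W Par P s e = Some n \<and> Q 1 (s\<lparr>reg := (reg s)(x := n)\<rparr>))"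
  "wp W Par P (SetMem d e) s Q \<longleftrightarrow>
    (\<exists>i n. aval W Par P s d = Some i \<and> i < length (mem s) \<and> aval W Par P s e = Some n \<and>
      Q 1 (s\<lparr>mem := (mem s)[i := n]\<rparr>))"
  "wp W Par P (SetArr b d e) s Q \<longleftrightarrow>
    (\<exists>a n. Option.bind (aval W Par P s d) (param_at Par P) = Some a \<and> aval W Par P s e = Some n \<and>
      Q 1 (s\<lparr>arr := (arr s)(b := (arr s b)(a := n))\<rparr>))"
  "wp W Par P (Seq c c') s Q \<longleftrightarrow> wp W Par P c s (\<lambda>t s'. wp W Par P c' s' (\<lambda>u. Q (t + u)))"
  "wp W Par P (Cond tst c c') s Q \<longleftrightarrow>
    (case bval W Par P s tst of None \<Rightarrow> False
      | Some v \<Rightarrow> wp W Par P (if v then c else c') s (\<lambda>t. Q (1 + t)))"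
  unfolding wp_def exec_simps by (auto split: option.splits if_splits) blast+

lemma wp_mono:
  assumes "wp W Par P c s Q" "\<And>t s'. Q t s' \<Longrightarrow> Q' t s'" shows "wp W Par P c s Q'"
  using assms unfolding wp_def by blast

lemma wp_SeqI:
  assumes "wp W Par P c s Q" "\<And>t s'. Q t s' \<Longrightarrow> wp W Par P d s' (\<lambda>u. R (t + u))"
  shows "wp W Par P (Seq c d) s R"
  unfolding wp_simps using assms by (rule wp_mono)

text \<open>\<open>V\<close> is a potential that pays for the body and one test per round, hence
  both a termination measure and a time bound. The final \<open>+ 1\<close> is the failing
  test.\<close>

lemma wp_While:
  fixes V :: "('v, 'b, 'a) state \<Rightarrow> nat"
  assumes "I s"
    and test: "\<And>s. I s \<Longrightarrow> bval W Par P s b \<noteq> None"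
    and step: "\<And>s. I s \<Longrightarrow> bval W Par P s b = Some True \<Longrightarrow>
      wp W Par P c s (\<lambda>t s'. I s' \<and> t + 1 + V s' \<le> V s)"
  shows "wp W Par P (While b c) s
    (\<lambda>t s'. I s' \<and> bval W Par P s' b = Some False \<and> t + V s' \<le> V s + 1)"
  using assms(1)
proof (induction "V s" arbitrary: s rule: less_induct)
  case less
  consider "bval W Par P s b = Some False" | "bval W Par P s b = Some True"
    using test[OF less.prems] by (cases "bval W Par P s b") auto
  then show ?case
  proof cases
    case 1
    then have "exec W Par P (While b c) s 1 s" by (rule exec.WhileFalse)
    then show ?thesis using 1 less.prems unfolding wp_def by fastforce
  next
    case 2
    then obtain t s' where body: "exec W Par P c s t s'" "I s'" "t + 1 + V s' \<le> V s"
      using step[OF less.prems] unfolding wp_def by blast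
    then obtain u s'' where "exec W Par P (While b c) s' u s''" "I s''"
        "bval W Par P s'' b = Some False" "u + V s'' \<le> V s' + 1"
      using less.hyps[of s'] unfolding wp_def by auto
    moreover have "exec W Par P (While b c) s (1 + t + u) s''"
      using 2 body(1) \<open>exec W Par P (While b c) s' u s''\<close> by (rule exec.WhileTrue)
    moreover have "1 + t + u + V s'' \<le> V s + 1"
      using body(3) \<open>u + V s'' \<le> V s' + 1\<close> by linarith
    ultimately show ?thesis unfolding wp_def by blast
  qed
qed

section \<open>The program\<close>

notation Seq (infixr ";;" 60)

abbreviation (input) "Le d e \<equiv> Neg (Less e d)"

abbreviation (input) "r_count \<equiv> 0 :: nat"
abbreviation (input) "r_k \<equiv> 2 :: nat"
abbreviation (input) "r_i \<equiv> 3 :: nat"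
abbreviation (input) "r_p \<equiv> 4 :: nat"
abbreviation (input) "r_q \<equiv> 5 :: nat"
abbreviation (input) "r_far \<equiv> 6 :: nat"
abbreviation (input) "r_match \<equiv> 7 :: nat"
abbreviation (input) "a_first \<equiv> 0 :: nat"
abbreviation (input) "a_occ \<equiv> 2 :: nat"

text \<open>The input is traversed backwards, so that the last write to \<open>a_first\<close> comes
  from the leftmost occurrence. The value \<open>Len\<close> in \<open>a_occ\<close> means that no
  occurrence is known.\<close>

definition init_arrays :: "(nat, nat) com" where
  "init_arrays =
     SetReg r_i Len ;;
     While (Less (Const 0) (Reg r_i))
       (SetReg r_i (Sub (Reg r_i) (Const 1)) ;;
        Cond (IsParam (Reg r_i)) (SetArr a_first (Reg r_i) (Reg r_i) ;; SetArr a_occ (Reg r_i) Len) Skip)"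

text \<open>Each parameter is counted at its first occurrence; starting from \<open>2\<close> yields
  \<open>k\<close> directly.\<close>

definition count_params :: "(nat, nat) com" where
  "count_params =
     SetReg r_k (Const 2) ;; SetReg r_i (Const 0) ;;
     While (Less (Reg r_i) Len)
       (Cond (IsParam (Reg r_i))
          (Cond (Eq (Arr a_first (Reg r_i)) (Reg r_i)) (SetReg r_k (Add (Reg r_k) (Const 1))) Skip) Skip ;;
        SetReg r_i (Add (Reg r_i) (Const 1)))"

abbreviation (input) "e_end \<equiv> Add (Reg r_p) (Reg r_q)"

text \<open>Tests are nested rather than joined where one guards the evaluation of another, since
  \<open>Conj\<close> evaluates both sides.\<close>

definition compare :: "(nat, nat) com" where
  "compare =
     SetReg r_match (Const 0) ;;
     Cond (Less e_end Len)
       (Cond (IsParam e_end)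
          (Cond (Conj (Le (Reg r_p) (Arr a_occ e_end)) (Less (Arr a_occ e_end) e_end))
            (Cond (SameChar (Sub (Arr a_occ e_end) (Reg r_p)) (Reg r_q)) (SetReg r_match (Const 1)) Skip)
            (Cond (IsParam (Reg r_q))
              (Cond (Eq (Arr a_first (Reg r_q)) (Reg r_q)) (SetReg r_match (Const 1)) Skip) Skip))
          (Cond (SameChar (Reg r_q) e_end) (SetReg r_match (Const 1)) Skip))
       Skip"

definition extend :: "(nat, nat) com" where
  "extend =
     Cond (IsParam e_end) (SetArr a_occ e_end e_end) Skip ;;
     SetReg r_q (Add (Reg r_q) (Const 1))"

definition record_period :: "(nat, nat) com" where
  "record_period =
     Cond (Conj (Le (Reg r_p) (Div e_end (Reg r_k))) (Less (Reg r_far) e_end))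
       (SetMem (Mul (Const 2) (Reg r_count)) (Reg r_p) ;;
        SetMem (Add (Mul (Const 2) (Reg r_count)) (Const 1)) e_end ;;
        SetReg r_count (Add (Reg r_count) (Const 1)) ;;
        SetReg r_far e_end)
       Skip"

text \<open>The list is increasing, so the stop is at the smallest listed period whose reach is at
  least \<open>q\<close>, or at the end of the list.\<close>

definition scan :: "(nat, nat) com" where
  "scan =
     SetReg r_i (Const 0) ;;
     While (Conj (Less (Reg r_i) (Reg r_count))
              (Less (Mem (Add (Mul (Const 2) (Reg r_i)) (Const 1))) (Reg r_q)))
       (SetReg r_i (Add (Reg r_i) (Const 1)))"

definition shift :: "(nat, nat) com" where
  "shift =
     Cond (Conj (Less (Reg r_i) (Reg r_count))
             (Le (Mem (Mul (Const 2) (Reg r_i))) (Div (Reg r_q) (Reg r_k))))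
       (SetReg r_p (Add (Reg r_p) (Mem (Mul (Const 2) (Reg r_i)))) ;;
        SetReg r_q (Sub (Reg r_q) (Mem (Mul (Const 2) (Reg r_i)))))
       (SetReg r_p (Add (Add (Reg r_p) (Div (Reg r_q) (Reg r_k))) (Const 1)) ;;
        SetReg r_q (Const 0))"

definition search :: "(nat, nat) com" where
  "search =
     SetReg r_p (Const 1) ;; SetReg r_q (Const 0) ;; SetReg r_count (Const 0) ;; SetReg r_far (Const 0) ;;
     While (Le (Reg r_p) (Div Len (Reg r_k)))
       (compare ;; Cond (Eq (Reg r_match) (Const 1)) extend (record_period ;; scan ;; shift))"

definition prefix_periods_prog :: "(nat, nat) com" where
  "prefix_periods_prog = init_arrays ;; count_params ;; search"

lemma space_prefix_periods_prog:
  "extra_space prefix_periods_prog Par S \<le> 8 + 3 * card Par + S"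
proof -
  have "regs prefix_periods_prog \<subseteq> {..<8}" "arrs prefix_periods_prog \<subseteq> {..<3}"
    by (simp_all add: prefix_periods_prog_def init_arrays_def count_params_def search_def compare_def
        extend_def record_period_def scan_def shift_def)
  then have "card (regs prefix_periods_prog) \<le> 8" "card (arrs prefix_periods_prog) \<le> 3"
    using card_mono[of "{..<8}"] card_mono[of "{..<3}"] by fastforce+
  then show ?thesis unfolding extra_space_def by (simp add: add_mono mult_le_mono1)
qed

section \<open>Correctness and cost\<close>

text \<open>Addresses and values stay within \<open>2 * m + 2\<close>. Two cells beyond the output
  are provided because the test of \<open>scan\<close> reads memory even when \<open>r_i\<close>
  equals \<open>r_count\<close>.\<close>

locale ram = pstring Par P for Par :: "'a set" and P :: "'a list" +
  fixes W S :: nat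
  assumes word_bound: "2 * m + 3 \<le> W"
    and memory_size: "S = 2 * card {p. prefix_period p} + 2"
begin

abbreviation "run \<equiv> wp W Par P :: (nat, nat) com \<Rightarrow> (nat, nat, 'a) state \<Rightarrow> _"

lemma word_Some [simp]: "n \<le> 2 * m + 2 \<Longrightarrow> word W n = Some n"
  using word_bound by (simp add: word_def)

lemma char_at_Some [simp]: "i < m \<Longrightarrow> char_at P i = Some (P ! i)"
  by (simp add: char_at_def)

lemma param_at_Some [simp]: "i < m \<Longrightarrow> P ! i \<in> Par \<Longrightarrow> param_at Par P i = Some (P ! i)"
  by (simp add: param_at_def)

definition first_ok :: "('a \<Rightarrow> nat) \<Rightarrow> bool" where
  "first_ok f \<longleftrightarrow> (\<forall>j<m. P ! j \<in> Par \<longrightarrow> (f (P ! j) = j \<longleftrightarrow> P ! j \<notin> set (take j P)))"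

text \<open>
  The array is not cleared when the window \<open>{p..<p + q}\<close> moves. Entries left over from earlier
  windows do no harm, because every entry below \<open>m\<close> is a position of its character.
\<close>

definition occ_ok :: "('a \<Rightarrow> nat) \<Rightarrow> nat \<Rightarrow> nat \<Rightarrow> bool" where
  "occ_ok f p q \<longleftrightarrow>
     (\<forall>j<m. P ! j \<in> Par \<longrightarrow> f (P ! j) < m \<longrightarrow> P ! f (P ! j) = P ! j) \<and>
     (\<forall>j. p \<le> j \<longrightarrow> j < p + q \<longrightarrow> P ! j \<in> Par \<longrightarrow> j \<le> f (P ! j) \<and> f (P ! j) < p + q)"

text \<open>For \<open>q = 0\<close> no upper bound on \<open>p\<close> is kept; the test of the
  main loop supplies it in the next round.\<close>

definition window_ok :: "(nat, nat, 'a) state \<Rightarrow> bool" where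
  "window_ok s \<longleftrightarrow> reg s r_k = k \<and> length (mem s) = S \<and> first_ok (arr s a_first) \<and>
     occ_ok (arr s a_occ) (reg s r_p) (reg s r_q) \<and> 0 < reg s r_p \<and>
     (reg s r_q = 0 \<or> reg s r_p + reg s r_q \<le> m) \<and> align Par P 0 (reg s r_p) (reg s r_q)"

definition listed :: "nat \<Rightarrow> (nat, nat, 'a) state \<Rightarrow> bool" where
  "listed n s \<longleftrightarrow> (\<exists>xs. sorted_wrt (<) xs \<and> set xs = {x. prefix_period x \<and> x < n} \<and>
     reg s r_count = length xs \<and>
     (\<forall>i<length xs. mem s ! (2 * i) = xs ! i \<and> mem s ! (2 * i + 1) = rch (xs ! i)))"

text \<open>The value \<open>0\<close> stands for the maximum of no reaches.\<close>

definition farthest :: "nat \<Rightarrow> nat \<Rightarrow> bool" where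
  "farthest n r \<longleftrightarrow> (\<forall>x. prefix_period x \<longrightarrow> x < n \<longrightarrow> rch x \<le> r) \<and>
     (r = 0 \<or> (\<exists>x. prefix_period x \<and> x < n \<and> rch x = r))"

section \<open>Preprocessing: first occurrences and the value of \<open>k\<close>\<close>

lemma init_arrays_spec:
  "run init_arrays s (\<lambda>t s'. first_ok (arr s' a_first) \<and> occ_ok (arr s' a_occ) 1 0 \<and>
     mem s' = mem s \<and> t \<le> 5 * m + 2)"
proof -
  \<comment> \<open>First occurrences are meant relative to the part from \<open>r_i\<close> on that
    is already traversed.\<close>
  define I :: "(nat, nat, 'a) state \<Rightarrow> bool" where "I s' \<longleftrightarrow> reg s' r_i \<le> m \<and> mem s' = mem s \<and>
    (\<forall>j. reg s' r_i \<le> j \<longrightarrow> j < m \<longrightarrow> P ! j \<in> Par \<longrightarrow>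
      arr s' a_occ (P ! j) = m \<and>
      (arr s' a_first (P ! j) = j \<longleftrightarrow> (\<forall>l. reg s' r_i \<le> l \<longrightarrow> l < j \<longrightarrow> P ! l \<noteq> P ! j)))" for s'
  show ?thesis
    unfolding init_arrays_def
  proof (rule wp_SeqI)
    show "run (SetReg r_i Len) s (\<lambda>t s'. t = 1 \<and> s' = s\<lparr>reg := (reg s)(r_i := m)\<rparr>)"
      by (simp add: wp_simps)
  next
    fix t :: nat and s' :: "(nat, nat, 'a) state" assume s': "t = 1 \<and> s' = s\<lparr>reg := (reg s)(r_i := m)\<rparr>"
    show "run (While (Less (Const 0) (Reg r_i))
         (SetReg r_i (Sub (Reg r_i) (Const 1)) ;;
          Cond (IsParam (Reg r_i)) (SetArr a_first (Reg r_i) (Reg r_i) ;; SetArr a_occ (Reg r_i) Len) Skip)) s'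
       (\<lambda>u s'. first_ok (arr s' a_first) \<and> occ_ok (arr s' a_occ) 1 0 \<and> mem s' = mem s \<and> t + u \<le> 5 * m + 2)"
    \<comment> \<open>Five steps per position: loop test, decrement, branch and two array
      writes.\<close>
    proof (rule wp_mono, rule wp_While[where I = I and V = "\<lambda>s. 5 * reg s r_i"])
      show "I s'" using s' by (simp add: I_def)
    next
      fix s' show "bval W Par P s' (Less (Const 0) (Reg r_i)) \<noteq> None" by simp
    next
      fix s' assume I: "I s'" and b: "bval W Par P s' (Less (Const 0) (Reg r_i)) = Some True"
      then obtain n where i: "reg s' r_i = Suc n" by (auto simp: gr0_conv_Suc)
      have n: "n < m" using I i by (simp add: I_def)
      have *: "arr s' a_occ (P ! j) = m"
          "arr s' a_first (P ! j) = j \<longleftrightarrow> (\<forall>l. n < l \<longrightarrow> l < j \<longrightarrow> P ! l \<noteq> P ! j)"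
        if "n < j" "j < m" "P ! j \<in> Par" for j
        using I i that by (simp_all add: I_def Suc_le_eq)
      have "n \<le> j \<longleftrightarrow> j = n \<or> n < j" for j by auto
      then show "run (SetReg r_i (Sub (Reg r_i) (Const 1)) ;;
          Cond (IsParam (Reg r_i)) (SetArr a_first (Reg r_i) (Reg r_i) ;; SetArr a_occ (Reg r_i) Len) Skip) s'
          (\<lambda>t s''. I s'' \<and> t + 1 + 5 * reg s'' r_i \<le> 5 * reg s' r_i)"
        using I i n * by (auto simp: wp_simps I_def)
    next
      fix u s'' assume "I s'' \<and> bval W Par P s'' (Less (Const 0) (Reg r_i)) = Some False \<and>
        u + 5 * reg s'' r_i \<le> 5 * reg s' r_i + 1"
      then show "first_ok (arr s'' a_first) \<and> occ_ok (arr s'' a_occ) 1 0 \<and> mem s'' = mem s \<and> t + u \<le> 5 * m + 2"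
        using s' by (auto simp: I_def first_ok_def occ_ok_def in_set_conv_nth)
    qed
  qed
qed

lemma params_take_Suc:
  "i < m \<Longrightarrow> params Par (take (Suc i) P) =
    (if P ! i \<in> Par then insert (P ! i) (params Par (take i P)) else params Par (take i P))"
  by (auto simp: params_def take_Suc_conv_app_nth)

lemma count_params_spec:
  assumes "first_ok (arr s a_first)"
  shows "run count_params s (\<lambda>t s'. arr s' = arr s \<and> mem s' = mem s \<and> reg s' r_k = k \<and> t \<le> 5 * m + 3)"
proof -
  define I :: "(nat, nat, 'a) state \<Rightarrow> bool" where "I s' \<longleftrightarrow> reg s' r_i \<le> m \<and> mem s' = mem s \<and>
    arr s' = arr s \<and> reg s' r_k = card (params Par (take (reg s' r_i) P)) + 2" for s'
  let ?s = "s\<lparr>reg := (reg s)(r_k := 2, r_i := 0)\<rparr>"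
  show ?thesis
    unfolding count_params_def
  proof (rule wp_SeqI[where Q = "\<lambda>t s'. t = 1 \<and> s' = s\<lparr>reg := (reg s)(r_k := 2)\<rparr>"],
      simp add: wp_simps,
      rule wp_SeqI[where Q = "\<lambda>t s'. t = 1 \<and> s' = ?s"], simp add: wp_simps)
    fix t t' :: nat and s' s'' :: "(nat, nat, 'a) state" assume *: "t = 1 \<and> s'' = s\<lparr>reg := (reg s)(r_k := 2)\<rparr>" "t' = 1 \<and> s' = ?s"
    show "run (While (Less (Reg r_i) Len)
       (Cond (IsParam (Reg r_i))
          (Cond (Eq (Arr a_first (Reg r_i)) (Reg r_i)) (SetReg r_k (Add (Reg r_k) (Const 1))) Skip) Skip ;;
        SetReg r_i (Add (Reg r_i) (Const 1)))) s'
       (\<lambda>u s'. arr s' = arr s \<and> mem s' = mem s \<and> reg s' r_k = k \<and> t + (t' + u) \<le> 5 * m + 3)"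
    proof (rule wp_mono, rule wp_While[where I = I and V = "\<lambda>s. 5 * (m - reg s r_i)"])
      show "I s'" using * by (simp add: I_def params_def)
    next
      fix s' show "bval W Par P s' (Less (Reg r_i) Len) \<noteq> None" by simp
    next
      fix s' assume I: "I s'" and b: "bval W Par P s' (Less (Reg r_i) Len) = Some True"
      obtain i where i: "reg s' r_i = i" by blast
      have im: "i < m" using b i by simp
      have rk: "reg s' r_k = card (params Par (take i P)) + 2" using I i by (simp add: I_def)
      have "card (params Par (take i P)) \<le> card (set P)"
        by (intro card_mono) (auto simp: params_def dest: in_set_takeD)
      then have card_le: "card (params Par (take i P)) \<le> m" using card_length[of P] by simp
      have "finite (params Par (take i P))" by (simp add: params_def)
      moreover have "P ! i \<in> Par \<Longrightarrow> arr s a_first (P ! i) = i \<longleftrightarrow> P ! i \<notin> params Par (take i P)"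
        using assms im by (simp add: first_ok_def params_def)
      ultimately show "run (Cond (IsParam (Reg r_i))
          (Cond (Eq (Arr a_first (Reg r_i)) (Reg r_i)) (SetReg r_k (Add (Reg r_k) (Const 1))) Skip) Skip ;;
        SetReg r_i (Add (Reg r_i) (Const 1))) s'
          (\<lambda>t s''. I s'' \<and> t + 1 + 5 * (m - reg s'' r_i) \<le> 5 * (m - reg s' r_i))"
        using I i im rk card_le
        by (auto simp: wp_simps I_def params_take_Suc insert_absorb)
    next
      fix u s'' assume "I s'' \<and> bval W Par P s'' (Less (Reg r_i) Len) = Some False \<and>
        u + 5 * (m - reg s'' r_i) \<le> 5 * (m - reg s' r_i) + 1"
      then show "arr s'' = arr s \<and> mem s'' = mem s \<and> reg s'' r_k = k \<and> t + (t' + u) \<le> 5 * m + 3"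
        using * by (auto simp: I_def k_def)
    qed
  qed
qed

section \<open>Comparing and extending the window\<close>

text \<open>By \<open>align_Suc_iff\<close> the new pair has to be compared with all
  \<open>q\<close> earlier ones; one known occurrence of the new letter in the window, or its
  absence, settles all of them.\<close>

lemma compare_spec:
  assumes "window_ok s" and pq: "reg s r_p = p" "reg s r_q = q" and p: "p \<le> m"
  shows "run compare s (\<lambda>t s'. t \<le> 7 \<and>
    s' = s\<lparr>reg := (reg s)(r_match := (if p + q < m \<and> align Par P 0 p (Suc q) then 1 else 0))\<rparr>)"
proof (cases "p + q < m")
  case False
  have "p + q \<le> m" using assms by (auto simp: window_ok_def)
  then show ?thesis using False pq by (simp add: compare_def wp_simps)
next
  case True
  have a: "align Par P 0 p q" and occ: "occ_ok (arr s a_occ) p q" and fst: "first_ok (arr s a_first)"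
    using assms by (auto simp: window_ok_def)
  have q: "q < m" using True by simp
  let ?a = "P ! q" and ?b = "P ! (p + q)"
  let ?B = "arr s a_occ ?b"
  note Suc_iff = align_Suc_iff[OF finite_Par a, unfolded add_0]
  have eq: "P ! i = ?a \<longleftrightarrow> P ! (p + i) = ?b" if "align Par P 0 p (Suc q)" "i < q" for i
    using that Suc_iff by blast
  show ?thesis
  proof (cases "?b \<in> Par")
    case False
    have "?a = ?b \<Longrightarrow> i < q \<Longrightarrow> P ! i = ?a \<longleftrightarrow> P ! (p + i) = ?b" for i
      using a False unfolding align_iff_pattern[OF finite_Par] by (metis add_0)
    then have "align Par P 0 p (Suc q) \<longleftrightarrow> ?a = ?b" unfolding Suc_iff using False by metis
    then show ?thesis using True q pq False by (simp add: compare_def wp_simps)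
  next
    case b: True
    show ?thesis
    proof (cases "p \<le> ?B \<and> ?B < p + q")
      case w: True
      \<comment> \<open>Position \<open>?B\<close> faces \<open>?B - p\<close>, and by the existing
        match the occurrences of the two letters face each other, so equality with \<open>?a\<close>
        at this one position is decisive.\<close>
      then have "P ! ?B = ?b" using occ True b by (simp add: occ_ok_def)
      then have B: "P ! (p + (?B - p)) = ?b" "?B - p < q" "?B - p < m" using w True by auto
      have "align Par P 0 p (Suc q)" if "P ! (?B - p) = ?a"
      proof -
        have "?a \<in> Par" using a B b that unfolding align_iff_pattern[OF finite_Par] by (metis add_0)
        moreover have "P ! i = ?a \<longleftrightarrow> P ! (p + i) = ?b" if "i < q" for i
          using a B(1,2) that \<open>P ! (?B - p) = ?a\<close> unfolding align_iff_pattern[OF finite_Par]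
          by (metis add_0)
        ultimately show ?thesis unfolding Suc_iff using b by blast
      qed
      then have "align Par P 0 p (Suc q) \<longleftrightarrow> P ! (?B - p) = ?a" using eq B by auto
      then show ?thesis using True q pq b w B(3) by (simp add: compare_def wp_simps)
    next
      case w: False
      \<comment> \<open>By \<open>occ_ok\<close> an occurrence of \<open>?b\<close> in the window
        would place \<open>?B\<close> there. So \<open>?b\<close> is new, and \<open>?a\<close> must
        be a parameter new to the prefix.\<close>
      have none: "P ! (p + i) \<noteq> ?b" if "i < q" for i
        using occ that w b by (auto simp: occ_ok_def dest: spec[of _ "p + i"])
      have "align Par P 0 p (Suc q) \<longleftrightarrow> ?a \<in> Par \<and> ?a \<notin> set (take q P)"
        unfolding Suc_iff using none b q by (auto simp: in_set_conv_nth)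
      moreover have "?a \<in> Par \<Longrightarrow> ?a \<notin> set (take q P) \<longleftrightarrow> arr s a_first ?a = q"
        using fst q by (simp add: first_ok_def)
      ultimately have "align Par P 0 p (Suc q) \<longleftrightarrow> ?a \<in> Par \<and> arr s a_first ?a = q" by auto
      then show ?thesis using True q pq b w
        by (cases "?a \<in> Par"; cases "?B < p") (simp_all add: compare_def wp_simps)
    qed
  qed
qed

lemma extend_spec:
  assumes "window_ok s" and pq: "reg s r_p = p" "reg s r_q = q"
    and "p + q < m" "align Par P 0 p (Suc q)"
  shows "run extend s (\<lambda>t s'. t \<le> 3 \<and> window_ok s' \<and> mem s' = mem s \<and>
    reg s' = (reg s)(r_q := Suc q))"
proof -
  have "occ_ok ((arr s a_occ)(P ! (p + q) := p + q)) p (Suc q)" if "P ! (p + q) \<in> Par"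
    using assms that by (auto simp: window_ok_def occ_ok_def less_Suc_eq)
  moreover have "occ_ok (arr s a_occ) p (Suc q)" if "P ! (p + q) \<notin> Par"
    using assms that by (auto simp: window_ok_def occ_ok_def less_Suc_eq)
  ultimately show ?thesis
    using assms by (auto simp: extend_def wp_simps window_ok_def)
qed

section \<open>Recording a prefix period\<close>

lemma listed_farthest_cong:
  assumes "\<And>x. prefix_period x \<Longrightarrow> x < n \<longleftrightarrow> x < n'"
  shows "listed n s \<longleftrightarrow> listed n' s" "farthest n r \<longleftrightarrow> farthest n' r"
proof -
  have "{x. prefix_period x \<and> x < n} = {x. prefix_period x \<and> x < n'}" using assms by auto
  then show "listed n s \<longleftrightarrow> listed n' s" by (simp add: listed_def)
  show "farthest n r \<longleftrightarrow> farthest n' r" using assms unfolding farthest_def by blast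
qed

lemma record_period_spec:
  assumes win: "window_ok s" and pq: "reg s r_p = p" "reg s r_q = q"
    and p: "p \<le> m div k" and reach: "rch p = p + q"
    and lst: "listed p s" and far: "farthest p (reg s r_far)"
  shows "run record_period s (\<lambda>t s'. t \<le> 5 \<and> window_ok s' \<and> reg s' r_p = p \<and> reg s' r_q = q \<and>
    listed (Suc p) s' \<and> farthest (Suc p) (reg s' r_far))"
proof -
  have p0: "0 < p" and rk: "reg s r_k = k" and len: "length (mem s) = S"
    using win pq by (auto simp: window_ok_def)
  have "m div k \<le> m" by simp
  with p have "p \<le> m" by (rule order_trans)
  then have pm: "p \<le> m" "p + q \<le> m" using win pq by (auto simp: window_ok_def)
  have iff: "prefix_period p \<longleftrightarrow> p \<le> (p + q) div k \<and> reg s r_far < p + q"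
  proof -
    \<comment> \<open>The comparison with all earlier reaches reduces to one with their maximum;
      \<open>0 < p + q\<close> covers the case that there are none.\<close>
    have "(\<forall>x. prefix_period x \<and> x < p \<longrightarrow> rch x < p + q) \<longleftrightarrow> reg s r_far < p + q"
      using far p0 unfolding farthest_def by (metis add_gr_0 order_le_less_trans)
    then show ?thesis using prefix_period_iff_record[OF p0 pm(1)] reach le_div_k_iff by simp
  qed
  obtain xs where xs: "sorted_wrt (<) xs" "set xs = {x. prefix_period x \<and> x < p}"
      "reg s r_count = length xs"
      "\<And>i. i < length xs \<Longrightarrow> mem s ! (2 * i) = xs ! i \<and> mem s ! (2 * i + 1) = rch (xs ! i)"
    using lst unfolding listed_def by blast
  show ?thesis
  proof (cases "prefix_period p")
    case False
    then have "x < p \<longleftrightarrow> x < Suc p" if "prefix_period x" for x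
      using that less_Suc_eq by auto
    then have "listed (Suc p) s" "farthest (Suc p) (reg s r_far)"
      using lst far listed_farthest_cong[of p "Suc p"] by blast+
    then show ?thesis using False iff pq rk pm win by (auto simp: record_period_def wp_simps)
  next
    case True
    have set: "set (xs @ [p]) = {x. prefix_period x \<and> x < Suc p}"
      using xs(2) True by (auto simp: less_Suc_eq)
    have sorted: "sorted_wrt (<) (xs @ [p])" using xs(1,2) by (auto simp: sorted_wrt_append)
    \<comment> \<open>The entries are distinct prefix periods, so the new pair still fits into the
      memory.\<close>
    have "length (xs @ [p]) = card (set (xs @ [p]))"
      using sorted by (metis distinct_card strict_sorted_iff)
    also have "\<dots> \<le> card {p. prefix_period p}"
      using finite_prefix_periods[of Par P] set by (intro card_mono) auto
    finally have room: "2 * length xs + 1 < S" by (simp add: memory_size)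
    have "card (set xs) \<le> card {0<..m}"
      using xs(2) prefix_period_bounds by (intro card_mono) auto
    then have small: "length xs \<le> m" using xs(1) by (simp add: distinct_card strict_sorted_iff)
    let ?mem = "(mem s)[2 * length xs := p, Suc (2 * length xs) := p + q]"
    have "?mem ! (2 * i) = (xs @ [p]) ! i \<and> ?mem ! (2 * i + 1) = rch ((xs @ [p]) ! i)"
      if "i < length (xs @ [p])" for i
    proof (cases "i < length xs")
      case True
      then show ?thesis using xs(4) by (simp add: nth_append)
    next
      case False
      then have "i = length xs" using that by simp
      then show ?thesis using room len reach by (simp add: nth_append)
    qed
    then have listed: "listed (Suc p) s'"
      if "reg s' r_count = Suc (length xs)" "mem s' = ?mem" for s' :: "(nat, nat, 'a) state"
      unfolding listed_def using sorted set that by (intro exI[of _ "xs @ [p]"]) auto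
    have "rch x \<le> p + q" if "prefix_period x" "x < Suc p" for x
    proof (cases "x = p")
      case False
      then have "rch x \<le> reg s r_far" using far that by (simp add: farthest_def)
      then show ?thesis using iff True by simp
    qed (simp add: reach)
    then have "farthest (Suc p) (p + q)" using True reach unfolding farthest_def by blast
    then show ?thesis using True iff pq rk pm win xs(3) room len small listed
      by (auto simp: record_period_def wp_simps window_ok_def)
  qed
qed

lemma listed_count_bounds:
  assumes "listed n s" shows "2 * reg s r_count + 1 < S" "reg s r_count \<le> m"
proof -
  obtain xs where xs: "sorted_wrt (<) xs" "set xs = {x. prefix_period x \<and> x < n}"
      "reg s r_count = length xs"
    using assms unfolding listed_def by blast
  have "length xs = card (set xs)" using xs(1) by (simp add: distinct_card strict_sorted_iff)
  also have "\<dots> \<le> card {p. prefix_period p}"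
    using finite_prefix_periods[of Par P] xs(2) by (intro card_mono) auto
  finally show "2 * reg s r_count + 1 < S" by (simp add: memory_size xs(3))
  have "card (set xs) \<le> card {0<..m}"
    using xs(2) prefix_period_bounds by (intro card_mono) auto
  then show "reg s r_count \<le> m" using \<open>length xs = card (set xs)\<close> by (simp add: xs(3))
qed

section \<open>Scanning the list and shifting the window\<close>

lemma scan_spec:
  assumes len: "length (mem s) = S" and q: "reg s r_q = q" and lst: "listed n s"
  shows "run scan s (\<lambda>t s'. \<exists>j. s' = s\<lparr>reg := (reg s)(r_i := j)\<rparr> \<and> j \<le> reg s r_count \<and>
    t \<le> 2 * j + 2 \<and> (\<forall>i<j. mem s ! (2 * i + 1) < q) \<and>
    (j < reg s r_count \<longrightarrow> q \<le> mem s ! (2 * j + 1)))"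
proof -
  let ?n = "reg s r_count"
  let ?test = "Conj (Less (Reg r_i) (Reg r_count))
    (Less (Mem (Add (Mul (Const 2) (Reg r_i)) (Const 1))) (Reg r_q)) :: (nat, nat) bexp"
  define I where "I s' \<longleftrightarrow> (\<exists>j\<le>?n. s' = s\<lparr>reg := (reg s)(r_i := j)\<rparr> \<and>
    (\<forall>i<j. mem s ! (2 * i + 1) < q))" for s' :: "(nat, nat, 'a) state"
  note bounds = listed_count_bounds[OF lst]
  have test: "bval W Par P s' ?test = Some (reg s' r_i < ?n \<and> mem s ! (2 * reg s' r_i + 1) < q)"
    if I: "I s'" for s'
  proof -
    obtain j where j: "j \<le> ?n" "s' = s\<lparr>reg := (reg s)(r_i := j)\<rparr>"
      using I unfolding I_def by blast
    \<comment> \<open>The address must be valid for \<open>j = ?n\<close> too, as both conjuncts are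
      evaluated.\<close>
    have "Suc (2 * j) < S" "Suc (2 * j) \<le> 2 * m + 2" using j(1) bounds by linarith+
    then show ?thesis using q len by (simp add: j(2))
  qed
  show ?thesis
    unfolding scan_def
  proof (rule wp_SeqI[where Q = "\<lambda>t s'. t = 1 \<and> s' = s\<lparr>reg := (reg s)(r_i := 0)\<rparr>"],
      simp add: wp_simps)
    fix t :: nat and s' :: "(nat, nat, 'a) state"
    assume s': "t = 1 \<and> s' = s\<lparr>reg := (reg s)(r_i := 0)\<rparr>"
    show "run (While ?test (SetReg r_i (Add (Reg r_i) (Const 1)))) s' (\<lambda>u s'.
      \<exists>j. s' = s\<lparr>reg := (reg s)(r_i := j)\<rparr> \<and> j \<le> ?n \<and> t + u \<le> 2 * j + 2 \<and>
        (\<forall>i<j. mem s ! (2 * i + 1) < q) \<and> (j < ?n \<longrightarrow> q \<le> mem s ! (2 * j + 1)))"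
    proof (rule wp_mono, rule wp_While[where I = I and V = "\<lambda>s'. 2 * (?n - reg s' r_i)"])
      show "I s'" using s' unfolding I_def by (intro exI[of _ 0]) simp
    next
      fix s' assume "I s'" then show "bval W Par P s' ?test \<noteq> None" by (subst test) simp_all
    next
      fix s' assume I: "I s'" and b: "bval W Par P s' ?test = Some True"
      obtain j where j: "s' = s\<lparr>reg := (reg s)(r_i := j)\<rparr>" "\<forall>i<j. mem s ! (2 * i + 1) < q"
        using I unfolding I_def by blast
      have lt: "j < ?n" "mem s ! (2 * j + 1) < q" using b test[OF I] j(1) by simp_all
      then show "run (SetReg r_i (Add (Reg r_i) (Const 1))) s'
          (\<lambda>t s''. I s'' \<and> t + 1 + 2 * (?n - reg s'' r_i) \<le> 2 * (?n - reg s' r_i))"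
        using bounds j by (auto simp: wp_simps I_def less_Suc_eq intro!: exI[of _ "Suc j"])
    next
      fix u s'' assume *: "I s'' \<and> bval W Par P s'' ?test = Some False \<and>
        u + 2 * (?n - reg s'' r_i) \<le> 2 * (?n - reg s' r_i) + 1"
      then obtain j where j: "j \<le> ?n" "s'' = s\<lparr>reg := (reg s)(r_i := j)\<rparr>"
          "\<forall>i<j. mem s ! (2 * i + 1) < q"
        unfolding I_def by blast
      have "\<not> (j < ?n \<and> mem s ! (2 * j + 1) < q)" using * test[of s''] j(2) by simp
      moreover have "u + 2 * (?n - reg s'' r_i) \<le> 2 * (?n - reg s' r_i) + 1" using * by blast
      then have "t + u \<le> 2 * j + 2" using s' j(1,2) by auto
      ultimately show "\<exists>j. s'' = s\<lparr>reg := (reg s)(r_i := j)\<rparr> \<and> j \<le> ?n \<and> t + u \<le> 2 * j + 2 \<and>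
        (\<forall>i<j. mem s ! (2 * i + 1) < q) \<and> (j < ?n \<longrightarrow> q \<le> mem s ! (2 * j + 1))"
        using j by (intro exI[of _ j]) auto
    qed
  qed
qed

text \<open>As \<open>x\<close> is a period of the prefix of length \<open>q\<close>, its first
  \<open>q - x\<close> letters match those at \<open>x\<close>, and through the old window those at
  \<open>p + x\<close>.\<close>

lemma shift_periodic_spec:
  assumes win: "window_ok s" and pq: "reg s r_p = p" "reg s r_q = q" and p: "p + q \<le> m"
    and j: "reg s r_i < reg s r_count" "reg s r_count \<le> m" "2 * reg s r_count \<le> S" "mem s ! (2 * reg s r_i) = x"
    and x: "k * x \<le> q" "prefix_period x" "q \<le> rch x"
  shows "run shift s (\<lambda>t s'. t \<le> 3 \<and> window_ok s' \<and> mem s' = mem s \<and>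
    reg s' = (reg s)(r_p := p + x, r_q := q - x))"
proof -
  have "1 * x \<le> k * x" using k_bounds by (intro mult_le_mono1) simp
  then have xq: "x \<le> q" using x(1) by linarith
  have a: "align Par P 0 p q" and occ: "occ_ok (arr s a_occ) p q" and rk: "reg s r_k = k"
    and len: "length (mem s) = S"
    using win pq by (auto simp: window_ok_def)
  have "prefix_has_period Par P x q"
    using prefix_has_period_iff_le_reach[of x q P Par] prefix_period_bounds[OF x(2)] x(3) xq p by simp
  then have "align Par P 0 x (q - x)" by (simp add: prefix_has_period_def)
  moreover have "align Par P (0 + x) (p + x) (q - x)" using a by (rule align_shift) (use xq in simp)
  ultimately have "align Par P 0 (p + x) (q - x)" using align_trans[of Par P 0 x] by simp
  \<comment> \<open>The right end of the window stays fixed, so the array entries remain correct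
    without any update.\<close>
  moreover have "occ_ok (arr s a_occ) (p + x) (q - x)" using occ xq by (auto simp: occ_ok_def)
  moreover have "x \<le> q div k" using x(1) le_div_k_iff by simp
  moreover have "2 * reg s r_i < S" using j by linarith
  ultimately show ?thesis using win pq j rk len p xq
    by (auto simp: shift_def wp_simps window_ok_def fun_upd_twist)
qed

lemma shift_aperiodic_spec:
  assumes win: "window_ok s" and pq: "reg s r_p = p" "reg s r_q = q" and p: "p + q \<le> m"
    and j: "reg s r_i \<le> reg s r_count" "reg s r_count \<le> m" "2 * reg s r_count < S"
    and x: "reg s r_i < reg s r_count \<Longrightarrow> q < k * mem s ! (2 * reg s r_i)"
  shows "run shift s (\<lambda>t s'. t \<le> 3 \<and> window_ok s' \<and> mem s' = mem s \<and>
    reg s' = (reg s)(r_p := p + q div k + 1, r_q := 0))"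
proof -
  have rk: "reg s r_k = k" and len: "length (mem s) = S"
    using win pq by (auto simp: window_ok_def)
  \<comment> \<open>For an empty window only the condition on entries below \<open>m\<close>
    remains, and it does not depend on the window.\<close>
  have "occ_ok (arr s a_occ) n 0" for n using win by (auto simp: window_ok_def occ_ok_def)
  moreover have "reg s r_i < reg s r_count \<Longrightarrow> q div k < mem s ! (2 * reg s r_i)"
    using x le_div_k_iff by (meson linorder_not_less)
  moreover have "2 * reg s r_i < S" using j by linarith
  moreover have "q div k \<le> q" by simp
  then have "p + q div k \<le> m" using p by linarith
  ultimately show ?thesis using win pq j rk len p align_0
    by (auto simp: shift_def wp_simps window_ok_def fun_upd_twist)
qed

section \<open>Amortised cost of the search\<close>

text \<open>
  A shift of the second kind decreases \<open>q\<close> by less than \<open>k\<close> times the increase of \<open>p\<close>, so each round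
  increases this measure at least in proportion to its cost.
\<close>

definition progress :: "(nat, nat, 'a) state \<Rightarrow> nat" where
  "progress s = 2 * (k * reg s r_p) + reg s r_q"

text \<open>The extreme case is a shift of the second kind, whose new progress is at most
  \<open>2 * m + 2 * m + 2 * k\<close> with \<open>k \<le> m + 2\<close>.\<close>

definition search_inv :: "(nat, nat, 'a) state \<Rightarrow> bool" where
  "search_inv s \<longleftrightarrow> window_ok s \<and> listed (reg s r_p) s \<and> farthest (reg s r_p) (reg s r_far) \<and>
     progress s \<le> 6 * m + 4"

lemma search_inv_shift:
  assumes "listed (Suc p) s" "farthest (Suc p) (reg s r_far)" "p < p'"
    and none: "\<And>x. p < x \<Longrightarrow> x < p' \<Longrightarrow> \<not> prefix_period x"
  shows "listed p' s" "farthest p' (reg s r_far)"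
proof -
  have "x < Suc p \<longleftrightarrow> x < p'" if "prefix_period x" for x
    using none[of x] assms(3) that by linarith
  then show "listed p' s" "farthest p' (reg s r_far)"
    using assms(1,2) listed_farthest_cong[of "Suc p" p'] by blast+
qed

text \<open>The \<open>12\<close> covers the loop test, the comparison and the branch before this
  code. Recording, scanning to index \<open>j\<close> and shifting take at most
  \<open>2 * j + 10\<close> steps, and \<open>j\<close> is bounded by the length of the
  shift.\<close>

lemma mismatch_spec:
  assumes win: "window_ok s" and pq: "reg s r_p = p" "reg s r_q = q"
    and p: "p \<le> m div k" and reach: "rch p = p + q"
    and lst: "listed p s" and far: "farthest p (reg s r_far)"
  shows "run (record_period ;; scan ;; shift) s (\<lambda>t s'. search_inv s' \<and>
    t + 12 + 20 * progress s \<le> 20 * progress s')"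
proof (rule wp_SeqI[OF record_period_spec[OF assms]], rule wp_SeqI)
  fix t :: nat and s1 assume s1: "t \<le> 5 \<and> window_ok s1 \<and> reg s1 r_p = p \<and> reg s1 r_q = q \<and>
    listed (Suc p) s1 \<and> farthest (Suc p) (reg s1 r_far)"
  then have len: "length (mem s1) = S" by (simp add: window_ok_def)
  show "run scan s1 (\<lambda>t s'. \<exists>j. s' = s1\<lparr>reg := (reg s1)(r_i := j)\<rparr> \<and> j \<le> reg s1 r_count \<and>
    t \<le> 2 * j + 2 \<and> (\<forall>i<j. mem s1 ! (2 * i + 1) < q) \<and>
    (j < reg s1 r_count \<longrightarrow> q \<le> mem s1 ! (2 * j + 1)))"
    using s1 len by (intro scan_spec) auto
  fix u s2 assume "\<exists>j. s2 = s1\<lparr>reg := (reg s1)(r_i := j)\<rparr> \<and> j \<le> reg s1 r_count \<and>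
    u \<le> 2 * j + 2 \<and> (\<forall>i<j. mem s1 ! (2 * i + 1) < q) \<and>
    (j < reg s1 r_count \<longrightarrow> q \<le> mem s1 ! (2 * j + 1))"
  then obtain j where j: "s2 = s1\<lparr>reg := (reg s1)(r_i := j)\<rparr>" "j \<le> reg s1 r_count"
    "u \<le> 2 * j + 2" "\<And>i. i < j \<Longrightarrow> mem s1 ! (2 * i + 1) < q"
    "j < reg s1 r_count \<Longrightarrow> q \<le> mem s1 ! (2 * j + 1)" by blast
  obtain xs where xs: "sorted_wrt (<) xs" "set xs = {x. prefix_period x \<and> x < Suc p}"
      "reg s1 r_count = length xs"
      "\<And>i. i < length xs \<Longrightarrow> mem s1 ! (2 * i) = xs ! i \<and> mem s1 ! (2 * i + 1) = rch (xs ! i)"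
    using s1 unfolding listed_def by blast
  have jn: "j \<le> length xs" using j(2) xs(3) by simp
  have mono: "xs ! i < xs ! l" if "i < l" "l < length xs" for i l
    using xs(1) that by (rule sorted_wrt_nth_less)
  have pp: "prefix_period (xs ! i) \<and> xs ! i \<le> p" if "i < length xs" for i
    using nth_mem[OF that] xs(2) by auto
  have count: "2 * reg s2 r_count + 1 < S" "reg s2 r_count \<le> m"
    using listed_count_bounds[of "Suc p" s1] s1 j(1) by auto
  have "listed (Suc p) s2" using s1 unfolding j(1) listed_def by simp
  moreover have "window_ok s2" using s1 j(1) by (auto simp: window_ok_def)
  ultimately have s2: "window_ok s2" "reg s2 r_p = p" "reg s2 r_q = q" "listed (Suc p) s2"
      "farthest (Suc p) (reg s2 r_far)" "reg s2 r_i = j" "mem s2 = mem s1" "reg s2 r_count = length xs"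
    using s1 j(1) xs(3) by auto
  have p0: "0 < p" and a: "align Par P 0 p q" using win pq by (auto simp: window_ok_def)
  have "m div k \<le> m" by simp
  with p have pm: "p \<le> m" by (rule order_trans)
  then have pqm: "p + q \<le> m" using win pq by (auto simp: window_ok_def)
  have kp: "k * p \<le> m" using p le_div_k_iff by simp
  have prog_s: "progress s = 2 * (k * p) + q" using pq by (simp add: progress_def)
  \<comment> \<open>The list contains every prefix period up to \<open>p\<close>, and those before
    index \<open>j\<close> were passed because their reach is below \<open>q\<close>.\<close>
  have early: "rch x < q" if "prefix_period x" "x \<le> p" "j < length xs \<Longrightarrow> x < xs ! j" for x
  proof -
    have "x \<in> set xs" using that xs(2) by auto
    then obtain i where i: "i < length xs" "x = xs ! i" by (auto simp: in_set_conv_nth)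
    have "\<not> j \<le> i"
    proof
      assume "j \<le> i"
      then show False using that(3) mono[of j i] i by (cases "i = j") auto
    qed
    then have "i < j" by simp
    then show ?thesis using j(4)[of i] xs(4)[of i] i by simp
  qed
  \<comment> \<open>The scan passes distinct periods, so its cost is bounded by the length of the shift.\<close>
  have index_le: "i \<le> b" if "i \<le> length xs" "\<And>l. l < i \<Longrightarrow> xs ! l \<le> b" for i b
  proof -
    have "distinct xs" using xs(1) by (simp add: strict_sorted_iff)
    then have "i = card (set (take i xs))" using that(1) by (simp add: distinct_card)
    also have "\<dots> \<le> card {0<..b}"
    proof (intro card_mono)
      show "set (take i xs) \<subseteq> {0<..b}"
      proof
        fix x assume "x \<in> set (take i xs)"
        then obtain l where "l < i" "l < length xs" "x = xs ! l" by (auto simp: in_set_conv_nth)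
        then show "x \<in> {0<..b}" using that(2) pp[of l] prefix_period_bounds(1) by auto
      qed
    qed simp
    finally show ?thesis by simp
  qed
  show "run shift s2 (\<lambda>v s'. search_inv s' \<and> t + (u + v) + 12 + 20 * progress s \<le> 20 * progress s')"
  proof (cases "j < length xs \<and> k * (xs ! j) \<le> q")
    case True
    define x where "x = xs ! j"
    have x: "prefix_period x" "k * x \<le> q" "q \<le> rch x" "mem s2 ! (2 * j) = x" "0 < x"
      using True pp[of j] j(5) xs(3) xs(4)[of j] s2 prefix_period_bounds(1) by (auto simp: x_def)
    have "1 * x \<le> k * x" using k_bounds by (intro mult_le_mono1) simp
    then have xq: "x \<le> q" using x(2) by linarith
    have none: "\<not> prefix_period y" if "p < y" "y < p + x" for y
    proof (rule no_prefix_period_skipped_periodic[OF p0 pqm a x(1,2) _ that])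
      show "rch y < q" if "prefix_period y" "y < x" for y
        using early[OF that(1)] that(2) pp[of j] True by (simp add: x_def)
    qed
    \<comment> \<open>The periods passed are all smaller than \<open>x\<close>. The progress gained
      is \<open>2 * k * x - x \<ge> 5 * x\<close>, which pays for them.\<close>
    have "j \<le> x" using index_le[of j x] mono True by (force simp: x_def)
    have gain: "2 * (k * (p + x)) = 2 * (k * p) + 2 * (k * x)" "3 * x \<le> k * x"
      using k_bounds(1) by (simp_all add: distrib_left)
    show ?thesis
    proof (rule wp_mono, rule shift_periodic_spec[OF s2(1-3) pqm _ _ _ _ x(2,1,3)])
      fix v :: nat and s' assume s': "v \<le> 3 \<and> window_ok s' \<and> mem s' = mem s2 \<and>
        reg s' = (reg s2)(r_p := p + x, r_q := q - x)"
      have "listed (p + x) s2" "farthest (p + x) (reg s2 r_far)"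
        using search_inv_shift[OF s2(4,5) _ none] x(5) by simp_all
      then have "listed (p + x) s'" "farthest (p + x) (reg s' r_far)"
        using s' by (simp_all add: listed_def)
      moreover have prog: "progress s' = 2 * (k * p) + 2 * (k * x) + (q - x)"
        using s' gain(1) by (simp add: progress_def)
      moreover have "progress s' \<le> 6 * m + 4" using prog x(2) kp pqm by linarith
      moreover have "t + (u + v) + 12 + 20 * progress s \<le> 20 * progress s'"
        using prog gain(2) conjunct1[OF s1] conjunct1[OF s'] j(3) \<open>j \<le> x\<close> x(5) xq prog_s by linarith
      ultimately show "search_inv s' \<and> t + (u + v) + 12 + 20 * progress s \<le> 20 * progress s'"
        using s' by (simp add: search_inv_def)
    qed (use s2 count True x(4) in auto)
  next
    case False
    define d where "d = q div k"
    have none: "\<not> prefix_period y" if "p < y" "y < p + d + 1" for y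
    proof (rule no_prefix_period_skipped_aperiodic[OF p0 pqm a _ that(1)])
      show "rch x < q" if "prefix_period x" "x \<le> p" "k * x \<le> q" for x
      proof (rule early[OF that(1,2)])
        assume "j < length xs"
        then have "\<not> k * (xs ! j) \<le> q" using False by simp
        then have "k * x < k * (xs ! j)" using that(3) by linarith
        then show "x < xs ! j" by simp
      qed
    qed (use that d_def in simp)
    \<comment> \<open>A period passed satisfies
      \<open>k * xs ! l \<le> rch (xs ! l) < q\<close>.\<close>
    have "j \<le> d"
    proof (rule index_le[OF jn])
      fix l assume "l < j"
      then have "rch (xs ! l) < q" "prefix_period (xs ! l)" using j(4) xs(4) pp jn by force+
      then have "k * (xs ! l) \<le> q" using prefix_period_bounds(2)[of "xs ! l"] by simp
      then show "xs ! l \<le> d" using le_div_k_iff by (simp add: d_def)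
    qed
    \<comment> \<open>Since \<open>q < k * d + k\<close>, the increase
      \<open>2 * k * d + 2 * k\<close> exceeds the lost \<open>q\<close> by more than
      \<open>k * d + k\<close>.\<close>
    have "\<not> Suc d \<le> q div k" by (simp add: d_def)
    then have "q < k * Suc d" using le_div_k_iff by simp
    moreover have "k * d \<le> q" by (simp add: d_def)
    moreover have "3 * d \<le> k * d" using k_bounds(1) by simp
    ultimately have gain: "q < k * d + k" "k * d \<le> q" "3 * d \<le> k * d" by simp_all
    show ?thesis
    proof (rule wp_mono, rule shift_aperiodic_spec[OF s2(1-3) pqm])
      fix v :: nat and s' assume s': "v \<le> 3 \<and> window_ok s' \<and> mem s' = mem s2 \<and>
        reg s' = (reg s2)(r_p := p + q div k + 1, r_q := 0)"
      have "listed (p + d + 1) s2" "farthest (p + d + 1) (reg s2 r_far)"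
        using search_inv_shift[OF s2(4,5) _ none] by simp_all
      then have "listed (p + d + 1) s'" "farthest (p + d + 1) (reg s' r_far)"
        using s' by (simp_all add: listed_def)
      moreover have prog: "progress s' = 2 * (k * p) + 2 * (k * d) + 2 * k"
        using s' by (simp add: progress_def d_def distrib_left)
      moreover have "progress s' \<le> 6 * m + 4" using prog gain(2) kp pqm k_bounds(2) by linarith
      moreover have "t + (u + v) + 12 + 20 * progress s \<le> 20 * progress s'"
        using prog gain conjunct1[OF s1] conjunct1[OF s'] j(3) \<open>j \<le> d\<close> k_bounds(1) prog_s by linarith
      ultimately show "search_inv s' \<and> t + (u + v) + 12 + 20 * progress s \<le> 20 * progress s'"
        using s' by (simp add: search_inv_def d_def)
    qed (use s2 count False j xs in \<open>auto simp: not_le\<close>)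
  qed
qed

lemma search_step:
  assumes inv: "search_inv s" and p: "reg s r_p \<le> m div k"
  shows "run (compare ;; Cond (Eq (Reg r_match) (Const 1)) extend (record_period ;; scan ;; shift)) s
    (\<lambda>t s'. search_inv s' \<and> t + 1 + 20 * progress s \<le> 20 * progress s')"
proof -
  obtain p q where pq: "reg s r_p = p" "reg s r_q = q" by blast
  have win: "window_ok s" and lst: "listed p s" and far: "farthest p (reg s r_far)"
    using inv pq by (auto simp: search_inv_def)
  have "m div k \<le> m" by simp
  with p have pm: "p \<le> m" unfolding pq by (rule order_trans)
  then have pqm: "p + q \<le> m" and a: "align Par P 0 p q" and p0: "0 < p"
    using win pq by (auto simp: window_ok_def)
  have kp: "k * p \<le> m" using p pq le_div_k_iff by simp
  let ?match = "p + q < m \<and> align Par P 0 p (Suc q)"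
  show ?thesis
  proof (rule wp_SeqI[OF compare_spec[OF win pq pm]])
    fix t :: nat and s1 assume s1: "t \<le> 7 \<and>
      s1 = s\<lparr>reg := (reg s)(r_match := (if p + q < m \<and> align Par P 0 p (Suc q) then 1 else 0))\<rparr>"
    then have s1': "window_ok s1" "reg s1 r_p = p" "reg s1 r_q = q" "listed p s1"
        "farthest p (reg s1 r_far)" "progress s1 = progress s"
      using win pq lst far by (auto simp: window_ok_def listed_def progress_def)
    show "run (Cond (Eq (Reg r_match) (Const 1)) extend (record_period ;; scan ;; shift)) s1
      (\<lambda>u s'. search_inv s' \<and> t + u + 1 + 20 * progress s \<le> 20 * progress s')"
    proof (cases ?match)
      case True
      then have "p + q < m" "align Par P 0 p (Suc q)" by auto
      then have "run extend s1 (\<lambda>u s'. search_inv s' \<and> t + (1 + u) + 1 + 20 * progress s \<le> 20 * progress s')"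
      proof (rule wp_mono[OF extend_spec[OF s1'(1-3)]])
        fix u :: nat and s' assume s': "u \<le> 3 \<and> window_ok s' \<and> mem s' = mem s1 \<and>
          reg s' = (reg s1)(r_q := Suc q)"
        then have "progress s' = Suc (progress s)" "progress s' = 2 * (k * p) + Suc q"
          using s1' pq by (simp_all add: progress_def)
        moreover have "progress s' \<le> 6 * m + 4" using calculation(2) kp True by linarith
        moreover have "listed p s'" "farthest p (reg s' r_far)" using s1' s' by (auto simp: listed_def)
        \<comment> \<open>One unit of progress pays 20 steps; a match takes at most 12: comparison
          7, branch 1, extension 3, loop test 1.\<close>
        ultimately show "search_inv s' \<and> t + (1 + u) + 1 + 20 * progress s \<le> 20 * progress s'"
          using s1 s' s1'(2) by (simp add: search_inv_def)
      qed
      then show ?thesis using s1 True by (simp add: wp_simps)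
    next
      case False
      have "p + q = m \<or> \<not> align Par P 0 p (Suc q)" using False pqm by auto
      then have "rch p = p + q" by (rule reach_at_mismatch[OF p0 pqm a])
      then have "run (record_period ;; scan ;; shift) s1
          (\<lambda>u s'. search_inv s' \<and> t + (1 + u) + 1 + 20 * progress s \<le> 20 * progress s')"
        using p pq s1 s1'(6)
        by (intro wp_mono[OF mismatch_spec[OF s1'(1-3) _ _ s1'(4,5)]]) auto
      then show ?thesis using s1 False by (simp add: wp_simps(6))
    qed
  qed
qed

lemma search_spec:
  assumes k: "reg s r_k = k" and len: "length (mem s) = S"
    and first: "first_ok (arr s a_first)" and occ: "occ_ok (arr s a_occ) 1 0"
  shows "run search s (\<lambda>t s'. length (mem s') = S \<and> listed (Suc m) s' \<and> t \<le> 120 * m + 85)"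
proof -
  let ?s = "s\<lparr>reg := (reg s)(r_p := 1, r_q := 0, r_count := 0, r_far := 0)\<rparr>"
  let ?test = "Le (Reg r_p) (Div Len (Reg r_k)) :: (nat, nat) bexp"
  let ?body = "compare ;; Cond (Eq (Reg r_match) (Const 1)) extend (record_period ;; scan ;; shift)"
  have none: "\<not> (prefix_period x \<and> x < Suc 0)" for x using prefix_period_bounds(1) by fastforce
  have "run (While ?test ?body) ?s (\<lambda>t s'. length (mem s') = S \<and> listed (Suc m) s' \<and> 4 + t \<le> 120 * m + 85)"
  \<comment> \<open>The potential is the progress still possible below the bound of
    \<open>search_inv\<close>. With the last test and the four initial assignments it gives
    \<open>20 * (6 * m + 4) + 5\<close>.\<close>
  proof (rule wp_mono, rule wp_While[where I = search_inv and V = "\<lambda>s. 20 * (6 * m + 4 - progress s)"])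
    have "window_ok ?s" using assms align_0 by (simp add: window_ok_def)
    moreover have "listed 1 ?s" "farthest 1 0" using none by (auto simp: listed_def farthest_def)
    moreover have "progress ?s \<le> 6 * m + 4" using k_bounds by (simp add: progress_def)
    ultimately show "search_inv ?s" by (simp add: search_inv_def)
  next
    fix s' assume "search_inv s'" then show "bval W Par P s' ?test \<noteq> None" by simp
  next
    fix s' assume inv: "search_inv s'" and "bval W Par P s' ?test = Some True"
    moreover have "reg s' r_k = k" using inv by (simp add: search_inv_def window_ok_def)
    ultimately have "reg s' r_p \<le> m div k" by simp
    then show "run ?body s' (\<lambda>t s''. search_inv s'' \<and>
        t + 1 + 20 * (6 * m + 4 - progress s'') \<le> 20 * (6 * m + 4 - progress s'))"
      by (rule wp_mono[OF search_step[OF inv]]) (auto simp: search_inv_def)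
  next
    fix t s' assume *: "search_inv s' \<and> bval W Par P s' ?test = Some False \<and>
      t + 20 * (6 * m + 4 - progress s') \<le> 20 * (6 * m + 4 - progress ?s) + 1"
    then have "reg s' r_k = k" by (simp add: search_inv_def window_ok_def)
    then have "m div k < reg s' r_p" using * by simp
    \<comment> \<open>After the loop \<open>p\<close> exceeds \<open>m div k\<close>, and no prefix
      period lies beyond that, so the list is complete.\<close>
    then have "x < reg s' r_p \<longleftrightarrow> x < Suc m" if "prefix_period x" for x
      using prefix_period_bounds(3,4)[OF that] by linarith
    moreover have "listed (reg s' r_p) s'" using * by (simp add: search_inv_def)
    ultimately have "listed (Suc m) s'"
      using listed_farthest_cong(1)[of "reg s' r_p" "Suc m" s'] by blast
    moreover have "t \<le> 20 * (6 * m + 4 - progress ?s) + 1"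
      using conjunct2[OF conjunct2[OF *]] by linarith
    then have "4 + t \<le> 120 * m + 85" by simp
    ultimately show "length (mem s') = S \<and> listed (Suc m) s' \<and> 4 + t \<le> 120 * m + 85"
      using conjunct1[OF *] by (simp add: search_inv_def window_ok_def)
  qed
  then show ?thesis by (simp add: search_def wp_simps add.assoc)
qed

section \<open>The whole program and its bounds\<close>

lemma prefix_periods_prog_spec:
  assumes "length (mem s) = S"
  shows "\<exists>t s' xs. exec W Par P prefix_periods_prog s t s' \<and> t \<le> 220 * m \<and>
    returns_pairs s' xs \<and> distinct xs \<and> set xs = {(p, rch p) | p. prefix_period p}"
proof -
  have "run prefix_periods_prog s (\<lambda>t s'. length (mem s') = S \<and> listed (Suc m) s' \<and> t \<le> 220 * m)"
    unfolding prefix_periods_prog_def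
  proof (rule wp_SeqI[OF init_arrays_spec], rule wp_SeqI[OF count_params_spec])
    fix t u :: nat and s1 s2 :: "(nat, nat, 'a) state"
    assume s1: "first_ok (arr s1 a_first) \<and> occ_ok (arr s1 a_occ) 1 0 \<and> mem s1 = mem s \<and> t \<le> 5 * m + 2"
    then show "first_ok (arr s1 a_first)" by simp
    assume s2: "arr s2 = arr s1 \<and> mem s2 = mem s1 \<and> reg s2 r_k = k \<and> u \<le> 5 * m + 3"
    \<comment> \<open>The sum is at most \<open>130 * m + 90\<close>, and \<open>1 \<le> m\<close>
      absorbs the constant.\<close>
    then have time: "t + (u + v) \<le> 220 * m" if "v \<le> 120 * m + 85" for v
      using s1 that length_pos by linarith
    show "run search s2 (\<lambda>v s'. length (mem s') = S \<and> listed (Suc m) s' \<and> t + (u + v) \<le> 220 * m)"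
      using s1 s2 assms time by (intro wp_mono[OF search_spec]) auto
  qed
  then obtain t s' where s': "exec W Par P prefix_periods_prog s t s'" "t \<le> 220 * m"
      "length (mem s') = S" "listed (Suc m) s'"
    unfolding wp_def by blast
  then obtain xs where xs: "sorted_wrt (<) xs" "set xs = {x. prefix_period x \<and> x < Suc m}"
      "reg s' r_count = length xs"
      "\<And>i. i < length xs \<Longrightarrow> mem s' ! (2 * i) = xs ! i \<and> mem s' ! (2 * i + 1) = rch (xs ! i)"
    unfolding listed_def by blast
  let ?ys = "map (\<lambda>p. (p, rch p)) xs"
  have "set xs = {x. prefix_period x}" using xs(2) prefix_period_bounds(4) by (auto simp: less_Suc_eq_le)
  then have "set ?ys = {(p, rch p) | p. prefix_period p}" by auto
  moreover have "distinct ?ys"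
    using xs(1) by (auto simp: distinct_map strict_sorted_iff inj_on_def)
  moreover have "returns_pairs s' ?ys"
    using xs(3,4) listed_count_bounds(1)[OF s'(4)] s'(3) by (simp add: returns_pairs_def)
  ultimately show ?thesis using s'(1,2) by blast
qed

end

theorem theorem1:
  "\<exists>(prog :: (nat, nat) com) (a :: nat) (b :: nat) (c :: nat).
     \<forall>(Con :: nat set) (Par :: nat set) (P :: nat list).
       finite Con \<longrightarrow> finite Par \<longrightarrow> Con \<inter> Par = {} \<longrightarrow>
       set P \<subseteq> Con \<union> Par \<longrightarrow> params Par P \<noteq> {} \<longrightarrow>
       (let m = length P; W = (m + card Par) ^ c in
        \<exists>S. real (extra_space prog Par S) \<le> real b * (log 2 (real m) + real (card Par)) \<and>
            (\<forall>s. start_state W Par S s \<longrightarrow>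
               (\<exists>t s' xs. exec W Par P prog s t s' \<and> t \<le> a * m \<and>
                  returns_pairs s' xs \<and> distinct xs \<and>
                  set xs = {(p, reach Par P p) | p. is_prefix_period Par P p})))"
proof (rule exI[of _ prefix_periods_prog], rule exI[of _ 220], rule exI[of _ 15], rule exI[of _ 3],
    intro allI impI)
  fix Con Par :: "nat set" and P :: "nat list"
  assume fin: "finite Par" and ne: "params Par P \<noteq> {}"
  define m where "m = length P"
  define W where "W = (m + card Par) ^ 3"
  define S where "S = 2 * card {p. is_prefix_period Par P p} + 2"
  have m: "0 < m" using ne by (auto simp: m_def params_def)
  have card: "0 < card Par" using fin ne by (auto simp: card_gt_0_iff params_def)
  \<comment> \<open>The exponent 3 suffices for every \<open>m\<close>; for \<open>m = 1\<close> and
    a single parameter the square would be \<open>4\<close>, below the required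
    \<open>5\<close>.\<close>
  have "2 * m + 3 \<le> (m + 1) ^ 3"
  proof -
    have "1 * 1 \<le> m * m" using m by (intro mult_le_mono) simp_all
    moreover have "(m + 1) ^ 3 = m * m * m + 3 * (m * m) + 3 * m + 1"
      by (simp add: power3_eq_cube algebra_simps)
    ultimately show ?thesis by linarith
  qed
  also have "(m + 1) ^ 3 \<le> W" unfolding W_def using card by (intro power_mono) simp_all
  finally interpret ram Par P W S
    by unfold_locales (use fin ne in \<open>simp_all add: m_def S_def\<close>)
  have "real (card {p. is_prefix_period Par P p}) \<le> 2 * log 2 m + 1"
    using card_prefix_periods[OF ne] by (simp add: m_def)
  then have "real S \<le> 4 * log 2 m + 4" by (simp add: S_def)
  moreover have "0 \<le> log 2 (real m)" using m by (subst zero_le_log_cancel_iff) auto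
  moreover have "real (extra_space prefix_periods_prog Par S) \<le> real (8 + 3 * card Par + S)"
    using space_prefix_periods_prog of_nat_le_iff by blast
  moreover have "1 \<le> real (card Par)" using card by simp
  \<comment> \<open>The space is at most \<open>12 + 3 * card Par + 4 * log 2 m\<close>, and
    \<open>1 \<le> card Par\<close> absorbs the 12 into the factor 15.\<close>
  ultimately have "real (extra_space prefix_periods_prog Par S) \<le> real 15 * (log 2 (real m) + real (card Par))"
    by simp
  moreover have "length (mem s) = S" if "start_state W Par S s" for s :: "(nat, nat, nat) state"
    using that by (simp add: start_state_def)
  ultimately show "let m = length P; W = (m + card Par) ^ 3 in
      \<exists>S. real (extra_space prefix_periods_prog Par S) \<le> real 15 * (log 2 (real m) + real (card Par)) \<and>
          (\<forall>s. start_state W Par S s \<longrightarrow>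
             (\<exists>t s' xs. exec W Par P prefix_periods_prog s t s' \<and> t \<le> 220 * m \<and>
                returns_pairs s' xs \<and> distinct xs \<and>
                set xs = {(p, reach Par P p) | p. is_prefix_period Par P p}))"
    unfolding Let_def m_def[symmetric] W_def[symmetric]
    using prefix_periods_prog_spec unfolding m_def by (intro exI[of _ S]) simp
qed

end
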